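(* Let $p$ be a prime and let $G$ be a finite abelian $p$-group with a chosen long presentation and associated composition series $\{1\}=G_0<G_1<\dots<G_N=G$. Let $0\le l<N$, let $e$ be the trivial primitive central idempotent of $\mathbb{Q}[G_l]$, and let $u$ be the new generator of the long presentation introduced at stage $l+1$, so that $G_{l+1}=\langle G_l,u\rangle$. Then, in the PCI-diagram over $\mathbb{Q}$ associated to this series, $e$ is adjacent to precisely two vertices at level $l+1$, namely $ee_u$ and $ee'_u$.
   Context: For $x\in G$, $e_x=\frac{1+x+\cdots+x^{p-1}}{p}\in\mathbb{Q}[G]$ and $e'_x=1-e_x$. The trivial primitive central idempotent of $\mathbb{Q}[G_l]$ is $\frac{1}{|G_l|}\sum_{g\in G_l}g$. Long presentation: write $G=\prod_{i=1}^m\prod_{j=1}^{l_i}C_{p^{r_i},j}$ with $r_1>r_2>\dots>r_m\ge1$, where $C_{p^{r_i},j}$ is the $j$-th of $l_i$ cyclic factors of order $p^{r_i}$. Each factor $C_{p^{r_i},j}$ is given long generators $x_{\{(r_i,j),a\}}$, $1\le a\le r_i$, with $x_{\{(r_i,j),r_i\}}$ generating the factor, $x_{\{(r_i,j),a\}}^p=x_{\{(r_i,j),a-1\}}$ for $a\ge2$, and $x_{\{(r_i,j),1\}}^p=1$. The long presentation of $G$ consists of all these generators and relations together with commutativity. The composition series is obtained by introducing the long generators one at a time, $G_{k}$ being the subgroup generated by the first $k$ of them; the cyclic factors are taken one after another with $i$ increasing and, for fixed $i$, $j$ decreasing, and within a factor the generators are introduced with $a$ increasing. So each $G_{k}/G_{k-1}$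 is cyclic of order $p$, and $|G|=p^N$. PCI-diagram over $\mathbb{Q}$: the graph whose vertices at level $k$ ($0\le k\le N$) are the primitive central idempotents of $\mathbb{Q}[G_k]$. A vertex $e$ at level $k$, with associated irreducible $\mathbb{Q}$-representation $\eta$ of $G_k$, is adjacent at level $k+1$ to exactly those primitive central idempotents of $\mathbb{Q}[G_{k+1}]$ whose associated irreducible $\mathbb{Q}$-representations occur in the induced representation $\mathrm{Ind}_{G_k}^{G_{k+1}}\eta$. *)

theory Defs
  imports
    "HOL-Algebra.Generated_Groups"
    "HOL-Algebra.Product_Groups"
    "HOL-Computational_Algebra.Primes"
    "Jordan_Normal_Form.VS_Connect"
begin

section \<open>Rational group algebras and their primitive central idempotents\<close>

text \<open>
  The rational group algebra of a finite group. Its elements are functions on the ambient type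
  vanishing off the carrier, rather than functions undefined off the carrier, so that the group
  algebra of a subgroup is literally contained in that of the whole group. The product is the
  convolution of functions.
\<close>

definition rat_group_algebra :: "('a, 'b) monoid_scheme \<Rightarrow> ('a \<Rightarrow> rat) ring" where
  "rat_group_algebra G =
    \<lparr> carrier = {f. \<forall>x. x \<notin> carrier G \<longrightarrow> f x = 0},
      mult = (\<lambda>f g x. if x \<in> carrier G
                      then \<Sum>y\<in>carrier G. f y * g (inv\<^bsub>G\<^esub> y \<otimes>\<^bsub>G\<^esub> x) else 0),
      one = (\<lambda>x. if x = \<one>\<^bsub>G\<^esub> then 1 else 0),
      zero = (\<lambda>x. 0),
      add = (\<lambda>f g x. f x + g x) \<rparr>"

definition central_idempotent :: "('r, 'm) ring_scheme \<Rightarrow> 'r \<Rightarrow> bool" where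
  "central_idempotent R e \<longleftrightarrow>
     e \<in> carrier R \<and> e \<otimes>\<^bsub>R\<^esub> e = e \<and> (\<forall>a\<in>carrier R. e \<otimes>\<^bsub>R\<^esub> a = a \<otimes>\<^bsub>R\<^esub> e)"

definition primitive_central_idempotent :: "('r, 'm) ring_scheme \<Rightarrow> 'r \<Rightarrow> bool" where
  "primitive_central_idempotent R e \<longleftrightarrow>
     central_idempotent R e \<and> e \<noteq> \<zero>\<^bsub>R\<^esub> \<and>
     \<not> (\<exists>f g. central_idempotent R f \<and> central_idempotent R g \<and>
          f \<noteq> \<zero>\<^bsub>R\<^esub> \<and> g \<noteq> \<zero>\<^bsub>R\<^esub> \<and> f \<otimes>\<^bsub>R\<^esub> g = \<zero>\<^bsub>R\<^esub> \<and> e = f \<oplus>\<^bsub>R\<^esub> g)"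

definition trivial_idempotent :: "'a set \<Rightarrow> 'a \<Rightarrow> rat" where
  "trivial_idempotent H = (\<lambda>x. if x \<in> H then 1 / of_nat (card H) else 0)"

text \<open>The element $(1 + x + \cdots + x^{p-1})/p$; it need not be idempotent, as the order of
  $x$ may exceed $p$.\<close>

definition e_elem :: "nat \<Rightarrow> ('a, 'b) monoid_scheme \<Rightarrow> 'a \<Rightarrow> 'a \<Rightarrow> rat" where
  "e_elem p G x = (\<lambda>y. (\<Sum>k<p. if y = x [^]\<^bsub>G\<^esub> k then 1 else 0) / of_nat p)"

definition e'_elem :: "nat \<Rightarrow> ('a, 'b) monoid_scheme \<Rightarrow> 'a \<Rightarrow> 'a \<Rightarrow> rat" where
  "e'_elem p G x =
     \<one>\<^bsub>rat_group_algebra G\<^esub> \<ominus>\<^bsub>rat_group_algebra G\<^esub> e_elem p G x"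


section \<open>Rational representations\<close>

abbreviation rat_field :: "rat ring" where
  "rat_field \<equiv> class_ring"

definition rat_rep ::
  "('a, 'b) monoid_scheme \<Rightarrow> (rat, 'v, 'm) module_scheme \<Rightarrow> ('a \<Rightarrow> 'v \<Rightarrow> 'v) \<Rightarrow> bool" where
  "rat_rep G V \<rho> \<longleftrightarrow>
     vectorspace rat_field V \<and>
     (\<forall>g\<in>carrier G. linear_map rat_field V V (\<rho> g)) \<and>
     (\<forall>v\<in>carrier V. \<rho> \<one>\<^bsub>G\<^esub> v = v) \<and>
     (\<forall>g\<in>carrier G. \<forall>h\<in>carrier G. \<forall>v\<in>carrier V. \<rho> (g \<otimes>\<^bsub>G\<^esub> h) v = \<rho> g (\<rho> h v))"

definition irreducible_rat_rep ::
  "('a, 'b) monoid_scheme \<Rightarrow> (rat, 'v, 'm) module_scheme \<Rightarrow> ('a \<Rightarrow> 'v \<Rightarrow> 'v) \<Rightarrow> bool" where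
  "irreducible_rat_rep G V \<rho> \<longleftrightarrow>
     rat_rep G V \<rho> \<and> carrier V \<noteq> {\<zero>\<^bsub>V\<^esub>} \<and>
     (\<forall>W. VectorSpace.subspace rat_field W V \<and> (\<forall>g\<in>carrier G. \<rho> g ` W \<subseteq> W) \<longrightarrow>
          W = {\<zero>\<^bsub>V\<^esub>} \<or> W = carrier V)"

text \<open>The linear extension of a representation to the group algebra.\<close>

definition algebra_action ::
  "('a, 'b) monoid_scheme \<Rightarrow> (rat, 'v, 'm) module_scheme \<Rightarrow> ('a \<Rightarrow> 'v \<Rightarrow> 'v) \<Rightarrow>
   ('a \<Rightarrow> rat) \<Rightarrow> 'v \<Rightarrow> 'v" where
  "algebra_action G V \<rho> a v = (\<Oplus>\<^bsub>V\<^esub>g\<in>carrier G. a g \<odot>\<^bsub>V\<^esub> \<rho> g v)"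

text \<open>The irreducible representation belonging to a primitive central idempotent $e$ is
  the one, unique up to isomorphism, on which $e$ acts as the identity.\<close>

definition associated_irrep ::
  "('a, 'b) monoid_scheme \<Rightarrow> ('a \<Rightarrow> rat) \<Rightarrow> (rat, 'v, 'm) module_scheme \<Rightarrow>
   ('a \<Rightarrow> 'v \<Rightarrow> 'v) \<Rightarrow> bool" where
  "associated_irrep G e V \<rho> \<longleftrightarrow>
     irreducible_rat_rep G V \<rho> \<and> (\<forall>v\<in>carrier V. algebra_action G V \<rho> e v = v)"

text \<open>The representation of a finite group $K$ induced from a representation $(V, \eta)$ of a
  subgroup $H$, in the model of the $H$-equivariant functions from $K$ to $V$, on which $K$ acts
  by right translation. As $K$ is finite, it is isomorphic to the tensor product model.\<close>

definition induced_space ::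
  "('a, 'b) monoid_scheme \<Rightarrow> 'a set \<Rightarrow> (rat, 'v, 'm) module_scheme \<Rightarrow> ('a \<Rightarrow> 'v \<Rightarrow> 'v) \<Rightarrow>
   (rat, 'a \<Rightarrow> 'v) module" where
  "induced_space K H V \<eta> =
    \<lparr> carrier = {f \<in> carrier K \<rightarrow>\<^sub>E carrier V.
                   \<forall>h\<in>H. \<forall>x\<in>carrier K. f (h \<otimes>\<^bsub>K\<^esub> x) = \<eta> h (f x)},
      mult = undefined,
      one = undefined,
      zero = (\<lambda>x\<in>carrier K. \<zero>\<^bsub>V\<^esub>),
      add = (\<lambda>f f'. \<lambda>x\<in>carrier K. f x \<oplus>\<^bsub>V\<^esub> f' x),
      smult = (\<lambda>c f. \<lambda>x\<in>carrier K. c \<odot>\<^bsub>V\<^esub> f x) \<rparr>"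

definition induced_action ::
  "('a, 'b) monoid_scheme \<Rightarrow> 'a \<Rightarrow> ('a \<Rightarrow> 'v) \<Rightarrow> 'a \<Rightarrow> 'v" where
  "induced_action K g f = (\<lambda>x\<in>carrier K. f (x \<otimes>\<^bsub>K\<^esub> g))"

definition occurs_in ::
  "('a, 'b) monoid_scheme \<Rightarrow> (rat, 'v, 'm) module_scheme \<Rightarrow> ('a \<Rightarrow> 'v \<Rightarrow> 'v) \<Rightarrow>
   (rat, 'w, 'n) module_scheme \<Rightarrow> ('a \<Rightarrow> 'w \<Rightarrow> 'w) \<Rightarrow> bool" where
  "occurs_in G V \<theta> W \<rho> \<longleftrightarrow>
     (\<exists>T. linear_map rat_field V W T \<and> inj_on T (carrier V) \<and>
          (\<forall>g\<in>carrier G. \<forall>v\<in>carrier V. T (\<theta> g v) = \<rho> g (T v)))"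


section \<open>The PCI-diagram of a chain of subgroups\<close>

text \<open>The irreducible representations in question are finite-dimensional, so they may be taken
  on the coordinate spaces of column vectors.\<close>

definition pci_branches ::
  "('a, 'b) monoid_scheme \<Rightarrow> 'a set \<Rightarrow> 'a set \<Rightarrow> ('a \<Rightarrow> rat) \<Rightarrow> ('a \<Rightarrow> rat) \<Rightarrow> bool" where
  "pci_branches G H K e f \<longleftrightarrow>
     (\<exists>n \<eta> d \<theta>.
        associated_irrep (G\<lparr>carrier := H\<rparr>) e (module_vec TYPE(rat) n) \<eta> \<and>
        associated_irrep (G\<lparr>carrier := K\<rparr>) f (module_vec TYPE(rat) d) \<theta> \<and>
        occurs_in (G\<lparr>carrier := K\<rparr>) (module_vec TYPE(rat) d) \<theta>
          (induced_space (G\<lparr>carrier := K\<rparr>) H (module_vec TYPE(rat) n) \<eta>)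
          (induced_action (G\<lparr>carrier := K\<rparr>)))"

text \<open>Vertices are tagged with their level, since the same element may be a primitive central
  idempotent at several levels.\<close>

definition pci_vertices ::
  "('a, 'b) monoid_scheme \<Rightarrow> (nat \<Rightarrow> 'a set) \<Rightarrow> nat \<Rightarrow> (nat \<times> ('a \<Rightarrow> rat)) set" where
  "pci_vertices G S N =
     {(k, e). k \<le> N \<and>
        primitive_central_idempotent (rat_group_algebra (G\<lparr>carrier := S k\<rparr>)) e}"

definition pci_edges ::
  "('a, 'b) monoid_scheme \<Rightarrow> (nat \<Rightarrow> 'a set) \<Rightarrow> nat \<Rightarrow> (nat \<times> ('a \<Rightarrow> rat)) set set" where
  "pci_edges G S N =
     {{(k, e), (Suc k, f)} | k e f.
        (k, e) \<in> pci_vertices G S N \<and> (Suc k, f) \<in> pci_vertices G S N \<and>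
        pci_branches G (S k) (S (Suc k)) e f}"


section \<open>Long presentations\<close>

text \<open>
  Here $c_i$ is the number of cyclic factors of order $p^{r_i}$, and \<open>x i j a\<close> stands for
  $x_{\{(r_i,j),a\}}$. The last condition says that $G$ is the internal direct product of the
  cyclic subgroups generated by the \<open>x i j (r i)\<close>.
\<close>

definition long_presentation ::
  "nat \<Rightarrow> ('a, 'b) monoid_scheme \<Rightarrow> nat \<Rightarrow> (nat \<Rightarrow> nat) \<Rightarrow> (nat \<Rightarrow> nat) \<Rightarrow>
   (nat \<Rightarrow> nat \<Rightarrow> nat \<Rightarrow> 'a) \<Rightarrow> bool" where
  "long_presentation p G m r c x \<longleftrightarrow>
     (\<forall>i\<in>{1..m}. 1 \<le> r i \<and> 1 \<le> c i) \<and>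
     (\<forall>i\<in>{1..m}. \<forall>i'\<in>{1..m}. i < i' \<longrightarrow> r i' < r i) \<and>
     (\<forall>i\<in>{1..m}. \<forall>j\<in>{1..c i}.
        (\<forall>a\<in>{1..r i}. x i j a \<in> carrier G) \<and>
        (\<forall>a\<in>{2..r i}. x i j a [^]\<^bsub>G\<^esub> p = x i j (a - 1)) \<and>
        x i j 1 [^]\<^bsub>G\<^esub> p = \<one>\<^bsub>G\<^esub> \<and>
        card (generate G {x i j (r i)}) = p ^ r i) \<and>
     (let I = (SIGMA i:{1..m}. {1..c i}) in
        (\<lambda>f. finprod G f I) \<in>
          iso (product_group I (\<lambda>(i, j). G\<lparr>carrier := generate G {x i j (r i)}\<rparr>)) G)"

text \<open>The long generators in their order of introduction: $i$ increasing, then $j$ decreasing,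
  then $a$ increasing.\<close>

definition long_generators ::
  "nat \<Rightarrow> (nat \<Rightarrow> nat) \<Rightarrow> (nat \<Rightarrow> nat) \<Rightarrow> (nat \<Rightarrow> nat \<Rightarrow> nat \<Rightarrow> 'a) \<Rightarrow> 'a list" where
  "long_generators m r c x =
     [x i j a. i \<leftarrow> [1..<Suc m], j \<leftarrow> rev [1..<Suc (c i)], a \<leftarrow> [1..<Suc (r i)]]"

definition generator_series :: "('a, 'b) monoid_scheme \<Rightarrow> 'a list \<Rightarrow> nat \<Rightarrow> 'a set" where
  "generator_series G xs k = generate G (set (take k xs))"

end

theory Submission
  imports Defs "Berlekamp_Zassenhaus.Factor_Bound"
begin

text \<open>
  Let $H = G_l$ and $K = G_{l+1}$. Since $u \notin H$ and $u^p \in H$, the quotient $K/H$ is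
  cyclic of order $p$, and $e\,\mathbb{Q}[K] \cong \mathbb{Q}[X]/(X^p - 1)$, which splits into
  $\mathbb{Q}[X]/(X - 1)$ and $\mathbb{Q}[X]/(1 + X + \cdots + X^{p-1})$. Both moduli are
  irreducible, the second one by Eisenstein's criterion, so the two units $ee_u$ and $ee'_u$ are
  primitive. A quotient $\mathbb{Q}[X]/(\Psi)$ embeds into the representation induced from the
  trivial one by sending $q$ to the function $x \mapsto \lambda(xq)$ for a nonzero linear
  functional $\lambda$. Conversely $H$ acts trivially on that induced representation, so a
  primitive central idempotent $f$ adjacent to $e$ satisfies $fe \neq 0$; as distinct primitive
  central idempotents are orthogonal and $e = ee_u + ee'_u$, it is $ee_u$ or $ee'_u$.
\<close>

text \<open>An edge asserts that concrete representations on column spaces exist. One direction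
  therefore has to exhibit irreducible modules in coordinates, while the converse meets an arbitrary
  \<open>\<eta>\<close> associated with \<open>e\<close>; that H acts trivially there is extracted
  from \<open>e\<close> acting as the identity, by averaging. To keep quotient groups out, K/H
  enters only as a map \<open>idx\<close> to the residues below n, which then serve as exponents of
  X. The same set-up with n = 1 and the factor X - 1 shows that the trivial idempotent of any finite
  abelian group is primitive and belongs to a one-dimensional module, which makes \<open>e\<close> a
  vertex. The powers of u below p represent the cosets of H in K, so the product of \<open>e\<close>
  and \<open>e_elem p G u\<close> is the trivial idempotent of K, although the second factor alone
  need not be idempotent. From the long presentation come the two facts on u: its p-th power is 1 or
  the preceding generator of the same factor, hence lies in H; and u itself is separated from H by
  its component in the direct product.\<close>

hide_const (open) up_ring.coeff up_ring.monom

section \<open>Irreducibility of prime cyclotomic polynomials\<close>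

text \<open>Let i and j be the least indices at which g and h have a coefficient prime to p. In
  coefficient i + j of the product all terms but one are divisible by p, so i + j is the degree of
  f. Hence i and j are the degrees of g and h, both positive, and p divides both constant
  terms.\<close>

lemma eisenstein_irreducible\<^sub>d:
  fixes f :: "int poly"
  assumes "prime p" and "degree f > 0" and "\<not> p dvd lead_coeff f"
    and dvd: "\<And>i. i < degree f \<Longrightarrow> p dvd coeff f i"
    and "\<not> p ^ 2 dvd coeff f 0"
  shows "irreducible\<^sub>d f"
proof (rule irreducible\<^sub>dI)
  show "degree f > 0" by fact
next
  fix g h :: "int poly"
  assume dg: "0 < degree g" "degree g < degree f" and dh: "0 < degree h" "degree h < degree f"
    and fgh: "f = g * h"
  have nz: "g \<noteq> 0" "h \<noteq> 0" using dg dh by auto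
  have deg: "degree f = degree g + degree h" using nz by (simp add: fgh degree_mult_eq)
  have "\<not> p dvd lead_coeff g" "\<not> p dvd lead_coeff h"
    using assms(3) by (auto simp: fgh lead_coeff_mult)
  define i where "i = (LEAST i. \<not> p dvd coeff g i)"
  define j where "j = (LEAST j. \<not> p dvd coeff h j)"
  have i: "\<not> p dvd coeff g i" unfolding i_def by (rule LeastI) fact
  have j: "\<not> p dvd coeff h j" unfolding j_def by (rule LeastI) fact
  have i': "p dvd coeff g k" if "k < i" for k using that not_less_Least unfolding i_def by blast
  have j': "p dvd coeff h k" if "k < j" for k using that not_less_Least unfolding j_def by blast
  have "i \<le> degree g" using \<open>\<not> p dvd lead_coeff g\<close> unfolding i_def by (rule Least_le)
  moreover have "j \<le> degree h" using \<open>\<not> p dvd lead_coeff h\<close> unfolding j_def by (rule Least_le)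
  moreover have "\<not> p dvd coeff f (i + j)"
  proof
    assume p: "p dvd coeff f (i + j)"
    have "coeff f (i + j) = (\<Sum>k\<le>i + j. coeff g k * coeff h (i + j - k))"
      by (simp add: fgh coeff_mult)
    also have "\<dots> = coeff g i * coeff h j + (\<Sum>k\<in>{..i + j} - {i}. coeff g k * coeff h (i + j - k))"
      by (subst sum.remove[of _ i]) auto
    finally have eq: "coeff f (i + j) = \<dots>" .
    have "p dvd (\<Sum>k\<in>{..i + j} - {i}. coeff g k * coeff h (i + j - k))"
    proof (rule dvd_sum)
      fix k assume k: "k \<in> {..i + j} - {i}"
      show "p dvd coeff g k * coeff h (i + j - k)"
      proof (cases "k < i")
        case True then show ?thesis using i' by simp
      next
        case False
        with k have "i + j - k < j" by auto
        then show ?thesis using j' by simp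
      qed
    qed
    with p eq have "p dvd coeff g i * coeff h j" by (metis dvd_add_left_iff)
    with i j \<open>prime p\<close> show False by (simp add: prime_dvd_mult_iff)
  qed
  \<comment> \<open>Below the degree of f every coefficient is divisible by p, so i + j cannot lie
    there.\<close>
  ultimately have "i = degree g" "j = degree h"
    using dvd[of "i + j"] deg by linarith+
  then have "p dvd coeff g 0" "p dvd coeff h 0" using i' j' dg dh by auto
  then have "p * p dvd coeff g 0 * coeff h 0" by (rule mult_dvd_mono)
  then show False using assms(5) by (simp add: fgh coeff_mult power2_eq_square)
qed

text \<open>For prime p this is the p-th cyclotomic polynomial; the general form also serves n = 1,
  where it is 1.\<close>

definition geometric_sum_poly :: "nat \<Rightarrow> rat poly" where
  "geometric_sum_poly p = (\<Sum>k<p. monom 1 k)"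

lemma geometric_sum_poly_mult: "[:-1, 1:] * geometric_sum_poly p = monom 1 p - 1"
proof -
  have "[:-1, 1:] = monom 1 1 - (1 :: rat poly)"
    by (rule poly_eqI) (simp add: coeff_pCons split: nat.splits)
  moreover have "monom 1 p - 1 = (monom 1 1 - 1 :: rat poly) * (\<Sum>k<p. monom 1 1 ^ k)"
    using power_diff_1_eq[of "monom 1 1 :: rat poly" p] by (simp add: monom_power)
  ultimately show ?thesis by (simp add: geometric_sum_poly_def monom_power)
qed

lemma coeff_geometric_sum_poly: "coeff (geometric_sum_poly p) i = (if i < p then 1 else 0)"
  by (simp add: geometric_sum_poly_def coeff_sum)

lemma degree_geometric_sum_poly: "degree (geometric_sum_poly p) = p - 1"
proof (cases "p = 0")
  case False
  show ?thesis
    by (rule antisym, rule degree_le) (use False in \<open>auto simp: coeff_geometric_sum_poly intro!: le_degree\<close>)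
qed (simp add: geometric_sum_poly_def)

text \<open>Multiplied by X, both sides become (X + 1)^p - 1, and X cancels. The right-hand side
  shows the Eisenstein data: leading coefficient 1, constant coefficient p, and binomial
  coefficients divisible by p in between.\<close>

lemma geometric_sum_poly_shift:
  "pcompose (geometric_sum_poly p) [:1, 1:] = of_int_poly (\<Sum>k<p. monom (int (p choose Suc k)) k)"
proof -
  have X: "[:1, 1:] ^ p = (\<Sum>k\<le>p. monom (of_nat (p choose k)) k :: rat poly)"
  proof -
    have "[:1, 1:] = monom 1 1 + (1 :: rat poly)"
      by (rule poly_eqI) (simp add: coeff_pCons split: nat.splits)
    then have "[:1, 1:] ^ p = (monom 1 1 + 1 :: rat poly) ^ p" by simp
    also have "\<dots> = (\<Sum>k\<le>p. of_nat (p choose k) * monom 1 1 ^ k)" by (simp add: binomial_ring)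
    also have "\<dots> = (\<Sum>k\<le>p. monom (of_nat (p choose k)) k)"
      by (intro sum.cong refl) (simp add: monom_power of_nat_poly smult_monom)
    finally show ?thesis .
  qed
  have "[:0, 1:] * pcompose (geometric_sum_poly p) [:1, 1:]
      = pcompose ([:-1, 1:] * geometric_sum_poly p) [:1, 1:]"
    by (simp only: pcompose_mult) (simp add: pcompose_pCons)
  also have "\<dots> = [:1, 1:] ^ p - 1"
    unfolding geometric_sum_poly_mult
    by (simp add: pcompose_diff pcompose_hom.hom_power monom_altdef[of 1 p] pcompose_pCons)
  also have "\<dots> = (\<Sum>k<p. monom (of_nat (p choose Suc k)) (Suc k))"
    unfolding X lessThan_Suc_atMost[symmetric] by (subst sum.lessThan_Suc_shift) simp
  also have "\<dots> = [:0, 1:] * of_int_poly (\<Sum>k<p. monom (int (p choose Suc k)) k)"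
    by (simp add: of_int_poly_hom.hom_sum monom_Suc sum_distrib_left sum_pCons_0_commute)
  finally show ?thesis by simp
qed

lemma irreducible_geometric_sum_poly:
  assumes "prime p"
  shows "irreducible (geometric_sum_poly p)"
proof -
  let ?f = "\<Sum>k<p. monom (int (p choose Suc k)) k :: int poly"
  have p: "p > 1" using assms by (rule prime_gt_1_nat)
  have c: "coeff ?f i = (if i < p then int (p choose Suc i) else 0)" for i
    by (simp add: coeff_sum)
  have d: "degree ?f = p - 1"
    by (rule antisym, rule degree_le) (use p in \<open>auto simp: c intro!: le_degree\<close>)
  have "irreducible\<^sub>d ?f"
  proof (rule eisenstein_irreducible\<^sub>d[of "int p"])
    show "prime (int p)" using assms by simp
    show "\<not> int p dvd lead_coeff ?f" unfolding d c using p by simp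
    show "int p dvd coeff ?f i" if "i < degree ?f" for i
      using that dvd_choose_prime[of "Suc i" p] assms unfolding d c by auto
    show "\<not> int p ^ 2 dvd coeff ?f 0"
      using p by (auto simp: c power2_eq_square dest: zdvd_imp_le)
  qed (use p d in auto)
  \<comment> \<open>Gauss's lemma carries irreducibility from the integers to the rationals. The
    substitution X + 1 respects products and degrees, so a factorization of the unshifted polynomial
    would give one of the shifted polynomial.\<close>
  then have irr: "irreducible\<^sub>d (pcompose (geometric_sum_poly p) [:1, 1:])"
    unfolding geometric_sum_poly_shift by (rule irreducible\<^sub>d_int_rat)
  have "irreducible\<^sub>d (geometric_sum_poly p)"
  proof (rule irreducible\<^sub>dI)
    show "0 < degree (geometric_sum_poly p)" using p by (simp add: degree_geometric_sum_poly)
  next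
    fix g h assume "degree g > 0" "degree g < degree (geometric_sum_poly p)"
      "degree h > 0" "degree h < degree (geometric_sum_poly p)" "geometric_sum_poly p = g * h"
    then show False
      using irreducible\<^sub>dD(2)[OF irr, of "pcompose g [:1,1:]" "pcompose h [:1,1:]"]
      by (simp add: degree_pcompose flip: pcompose_mult)
  qed
  then show ?thesis by simp
qed

section \<open>The group algebra of a finite abelian group\<close>

lemma carrier_rat_group_algebra:
  "carrier (rat_group_algebra G) = {f. \<forall>x. x \<notin> carrier G \<longrightarrow> f x = 0}"
  by (simp add: rat_group_algebra_def)

lemma add_rat_group_algebra: "f \<oplus>\<^bsub>rat_group_algebra G\<^esub> g = (\<lambda>x. f x + g x)"
  by (simp add: rat_group_algebra_def)

lemma zero_rat_group_algebra: "\<zero>\<^bsub>rat_group_algebra G\<^esub> = (\<lambda>x. 0)"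
  by (simp add: rat_group_algebra_def)

lemma one_rat_group_algebra: "\<one>\<^bsub>rat_group_algebra G\<^esub> = (\<lambda>x. if x = \<one>\<^bsub>G\<^esub> then 1 else 0)"
  by (simp add: rat_group_algebra_def)

lemma mult_rat_group_algebra:
  "f \<otimes>\<^bsub>rat_group_algebra G\<^esub> g =
    (\<lambda>x. if x \<in> carrier G then \<Sum>y\<in>carrier G. f y * g (inv\<^bsub>G\<^esub> y \<otimes>\<^bsub>G\<^esub> x) else 0)"
  by (simp add: rat_group_algebra_def)

context comm_group
begin

lemma sum_carrier_translate:
  assumes "a \<in> carrier G"
  shows "(\<Sum>y\<in>carrier G. F (a \<otimes> y)) = (\<Sum>y\<in>carrier G. F y)"
  by (rule sum.reindex_bij_witness[of _ "\<lambda>y. inv a \<otimes> y" "\<lambda>y. a \<otimes> y"])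
     (use assms in \<open>auto simp: m_assoc[symmetric]\<close>)

lemma rat_group_algebra_mult_commute:
  "f \<otimes>\<^bsub>rat_group_algebra G\<^esub> g = g \<otimes>\<^bsub>rat_group_algebra G\<^esub> f"
proof (rule ext)
  fix x
  show "(f \<otimes>\<^bsub>rat_group_algebra G\<^esub> g) x = (g \<otimes>\<^bsub>rat_group_algebra G\<^esub> f) x"
  proof (cases "x \<in> carrier G")
    case True
    have "(\<Sum>y\<in>carrier G. f y * g (inv y \<otimes> x)) = (\<Sum>y\<in>carrier G. f (inv y \<otimes> x) * g y)"
      by (rule sum.reindex_bij_witness[of _ "\<lambda>y. inv y \<otimes> x" "\<lambda>y. inv y \<otimes> x"])
         (use True in \<open>auto simp: inv_mult m_ac simp flip: m_assoc\<close>)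
    then show ?thesis using True by (simp add: mult_rat_group_algebra mult.commute)
  qed (simp add: mult_rat_group_algebra)
qed

text \<open>Exchange of summation followed by the translation x = y z, for any family of additive
  maps \<open>M x\<close>. It yields associativity, multiplicativity of \<open>index_poly\<close>
  modulo X^n - 1, and the action of a product on a representation.\<close>

lemma sum_convolution:
  fixes M :: "'a \<Rightarrow> rat \<Rightarrow> 'c::comm_monoid_add"
  assumes add: "\<And>x a b. M x (a + b) = M x a + M x b" and zero: "\<And>x. M x 0 = 0"
  shows "(\<Sum>x\<in>carrier G. M x ((f \<otimes>\<^bsub>rat_group_algebra G\<^esub> g) x)) =
    (\<Sum>y\<in>carrier G. \<Sum>z\<in>carrier G. M (y \<otimes> z) (f y * g z))"
proof -
  have M_sum: "M x (\<Sum>y\<in>A. t y) = (\<Sum>y\<in>A. M x (t y))" for x A and t :: "'a \<Rightarrow> rat"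
    by (induction A rule: infinite_finite_induct) (simp_all add: add zero)
  have "(\<Sum>x\<in>carrier G. M x ((f \<otimes>\<^bsub>rat_group_algebra G\<^esub> g) x)) =
      (\<Sum>x\<in>carrier G. \<Sum>y\<in>carrier G. M x (f y * g (inv y \<otimes> x)))"
    by (simp add: mult_rat_group_algebra M_sum)
  also have "\<dots> = (\<Sum>y\<in>carrier G. \<Sum>x\<in>carrier G. M x (f y * g (inv y \<otimes> x)))"
    by (rule sum.swap)
  also have "\<dots> = (\<Sum>y\<in>carrier G. \<Sum>z\<in>carrier G. M (y \<otimes> z) (f y * g z))"
  proof (rule sum.cong[OF refl])
    fix y assume y: "y \<in> carrier G"
    have "(\<Sum>x\<in>carrier G. M x (f y * g (inv y \<otimes> x)))
        = (\<Sum>z\<in>carrier G. M (y \<otimes> z) (f y * g (inv y \<otimes> (y \<otimes> z))))"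
      by (rule sum_carrier_translate[OF y, symmetric])
    also have "\<dots> = (\<Sum>z\<in>carrier G. M (y \<otimes> z) (f y * g z))"
      by (rule sum.cong) (use y in \<open>simp_all flip: m_assoc\<close>)
    finally show "(\<Sum>x\<in>carrier G. M x (f y * g (inv y \<otimes> x))) = \<dots>" .
  qed
  finally show ?thesis .
qed

lemma rat_group_algebra_mult_assoc:
  "(f \<otimes>\<^bsub>rat_group_algebra G\<^esub> g) \<otimes>\<^bsub>rat_group_algebra G\<^esub> h =
    f \<otimes>\<^bsub>rat_group_algebra G\<^esub> (g \<otimes>\<^bsub>rat_group_algebra G\<^esub> h)"
proof (rule ext)
  fix x
  show "((f \<otimes>\<^bsub>rat_group_algebra G\<^esub> g) \<otimes>\<^bsub>rat_group_algebra G\<^esub> h) x =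
    (f \<otimes>\<^bsub>rat_group_algebra G\<^esub> (g \<otimes>\<^bsub>rat_group_algebra G\<^esub> h)) x"
  proof (cases "x \<in> carrier G")
    case True
    have "((f \<otimes>\<^bsub>rat_group_algebra G\<^esub> g) \<otimes>\<^bsub>rat_group_algebra G\<^esub> h) x =
        (\<Sum>y\<in>carrier G. (f \<otimes>\<^bsub>rat_group_algebra G\<^esub> g) y * h (inv y \<otimes> x))"
      using True by (subst mult_rat_group_algebra) simp
    also have "\<dots> = (\<Sum>y\<in>carrier G. \<Sum>z\<in>carrier G. f y * g z * h (inv (y \<otimes> z) \<otimes> x))"
      \<comment> \<open>The additive map is
        \<open>M y a = a * h (inv y \<otimes> x)\<close>.\<close>
      by (rule sum_convolution) (simp_all add: algebra_simps)
    also have "\<dots> = (\<Sum>y\<in>carrier G. f y * (g \<otimes>\<^bsub>rat_group_algebra G\<^esub> h) (inv y \<otimes> x))"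
      using True by (intro sum.cong refl)
        (simp add: mult_rat_group_algebra sum_distrib_left inv_mult m_ac mult.assoc)
    also have "\<dots> = (f \<otimes>\<^bsub>rat_group_algebra G\<^esub> (g \<otimes>\<^bsub>rat_group_algebra G\<^esub> h)) x"
      using True by (subst (2) mult_rat_group_algebra) simp
    finally show ?thesis .
  qed (simp add: mult_rat_group_algebra)
qed

lemma cring_rat_group_algebra:
  assumes "finite (carrier G)"
  shows "cring (rat_group_algebra G)"
proof (rule cringI)
  show "abelian_group (rat_group_algebra G)"
  proof (rule abelian_groupI)
    fix f assume "f \<in> carrier (rat_group_algebra G)"
    then show "\<exists>g\<in>carrier (rat_group_algebra G). g \<oplus>\<^bsub>rat_group_algebra G\<^esub> f = \<zero>\<^bsub>rat_group_algebra G\<^esub>"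
      by (intro bexI[of _ "\<lambda>x. - f x"]) (auto simp: rat_group_algebra_def)
  qed (auto simp: rat_group_algebra_def)
  show "comm_monoid (rat_group_algebra G)"
  proof (rule comm_monoidI)
    fix f assume f: "f \<in> carrier (rat_group_algebra G)"
    show "\<one>\<^bsub>rat_group_algebra G\<^esub> \<otimes>\<^bsub>rat_group_algebra G\<^esub> f = f"
    proof
      fix x show "(\<one>\<^bsub>rat_group_algebra G\<^esub> \<otimes>\<^bsub>rat_group_algebra G\<^esub> f) x = f x"
      proof (cases "x \<in> carrier G")
        case True
        have "(\<Sum>y\<in>carrier G. (if y = \<one> then 1 else 0) * f (inv y \<otimes> x))
            = (\<Sum>y\<in>carrier G. if y = \<one> then f (inv y \<otimes> x) else 0)"
          by (rule sum.cong) auto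
        also have "\<dots> = f x" using True assms by simp
        finally show ?thesis
          using True by (simp add: mult_rat_group_algebra one_rat_group_algebra)
      qed (use f in \<open>simp add: mult_rat_group_algebra carrier_rat_group_algebra\<close>)
    qed
  qed (rule rat_group_algebra_mult_assoc rat_group_algebra_mult_commute | simp add: rat_group_algebra_def)+
  show "(f \<oplus>\<^bsub>rat_group_algebra G\<^esub> g) \<otimes>\<^bsub>rat_group_algebra G\<^esub> h =
      f \<otimes>\<^bsub>rat_group_algebra G\<^esub> h \<oplus>\<^bsub>rat_group_algebra G\<^esub> g \<otimes>\<^bsub>rat_group_algebra G\<^esub> h" for f g h
    by (rule ext) (simp add: mult_rat_group_algebra add_rat_group_algebra algebra_simps sum.distrib)
qed

lemma minus_rat_group_algebra:
  assumes "finite (carrier G)" "f \<in> carrier (rat_group_algebra G)" "g \<in> carrier (rat_group_algebra G)"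
  shows "f \<ominus>\<^bsub>rat_group_algebra G\<^esub> g = (\<lambda>x. f x - g x)"
proof -
  interpret A: cring "rat_group_algebra G" using assms(1) by (rule cring_rat_group_algebra)
  have "\<ominus>\<^bsub>rat_group_algebra G\<^esub> g = (\<lambda>x. - g x)"
    by (rule A.minus_equality)
       (use assms in \<open>auto simp: carrier_rat_group_algebra add_rat_group_algebra zero_rat_group_algebra\<close>)
  then show ?thesis by (simp add: a_minus_def add_rat_group_algebra)
qed

end

text \<open>Otherwise f g and f - f g are two nonzero orthogonal idempotents with sum f, against
  primitivity.\<close>

lemma (in cring) primitive_central_idempotent_mult_eq:
  assumes f: "primitive_central_idempotent R f" and g: "central_idempotent R g"
    and nz: "f \<otimes> g \<noteq> \<zero>"
  shows "f \<otimes> g = f"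
proof (rule ccontr)
  assume ne: "f \<otimes> g \<noteq> f"
  have c: "f \<in> carrier R" "g \<in> carrier R" and ff: "f \<otimes> f = f" and gg: "g \<otimes> g = g"
    using f g by (auto simp: primitive_central_idempotent_def central_idempotent_def)
  let ?a = "f \<otimes> g" and ?b = "f \<ominus> f \<otimes> g"
  have cl: "?a \<in> carrier R" "?b \<in> carrier R" using c by auto
  have aa: "?a \<otimes> ?a = ?a"
  proof -
    have "?a \<otimes> ?a = (f \<otimes> f) \<otimes> (g \<otimes> g)" using c by (simp add: m_ac)
    then show ?thesis by (simp add: ff gg)
  qed
  have fa: "f \<otimes> ?a = ?a" using c by (simp add: ff flip: m_assoc)
  have ab: "?a \<otimes> ?b = \<zero>"
    using c cl aa fa m_comm[of ?a f] by (simp add: a_minus_def r_distr r_minus r_neg)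
  have bb: "?b \<otimes> ?b = ?b"
  proof -
    have "?b \<otimes> ?b = f \<otimes> ?b \<ominus> ?a \<otimes> ?b" using c cl by (simp add: a_minus_def l_distr l_minus)
    also have "\<dots> = f \<otimes> ?b" using c cl ab by (simp add: a_minus_def)
    also have "\<dots> = ?b" using c cl ff fa by (simp add: a_minus_def r_distr r_minus)
    finally show ?thesis .
  qed
  have "?b \<noteq> \<zero>" using ne c cl by auto
  moreover have "f = ?a \<oplus> ?b" using c cl by (simp add: a_minus_def a_lcomm[of ?a f] r_neg)
  moreover have "central_idempotent R ?a" "central_idempotent R ?b"
    using cl aa bb m_comm by (auto simp: central_idempotent_def)
  ultimately show False using f nz ab unfolding primitive_central_idempotent_def by blast
qed

text \<open>Used in contrapositive form: distinct primitive central idempotents are orthogonal.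
  Absorption in both directions gives f = f g = g.\<close>

lemma (in cring) primitive_central_idempotent_eqI:
  assumes "primitive_central_idempotent R f" and "primitive_central_idempotent R g"
    and "f \<otimes> g \<noteq> \<zero>"
  shows "f = g"
proof -
  have c: "central_idempotent R f" "central_idempotent R g" "f \<in> carrier R" "g \<in> carrier R"
    using assms unfolding primitive_central_idempotent_def central_idempotent_def by blast+
  have comm: "g \<otimes> f = f \<otimes> g" using c(3,4) by (rule m_comm[rotated])
  have "f \<otimes> g = f" using assms(1) c(2) assms(3) by (rule primitive_central_idempotent_mult_eq)
  moreover have "g \<otimes> f = g"
    using assms(2) c(1) assms(3) unfolding comm[symmetric]
    by (rule primitive_central_idempotent_mult_eq)
  ultimately show ?thesis by (simp add: comm)
qed

section \<open>Groups with a cyclic quotient\<close>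

lemma trivial_idempotent_closed:
  assumes "H \<subseteq> carrier G"
  shows "trivial_idempotent H \<in> carrier (rat_group_algebra G)"
  using assms by (auto simp: trivial_idempotent_def carrier_rat_group_algebra)

text \<open>\<open>idx\<close> is a surjective homomorphism onto Z/n, with residues coded as natural
  numbers below n so that they can be exponents of X. The quotient by the kernel is thus present
  without cosets.\<close>

locale cyclic_quotient = comm_group G for G (structure) +
  fixes n :: nat and idx :: "'a \<Rightarrow> nat"
  assumes finite_carrier: "finite (carrier G)"
    and idx_less: "x \<in> carrier G \<Longrightarrow> idx x < n"
    and idx_mult: "x \<in> carrier G \<Longrightarrow> y \<in> carrier G \<Longrightarrow> idx (x \<otimes> y) = (idx x + idx y) mod n"
    and idx_surj: "i < n \<Longrightarrow> \<exists>x\<in>carrier G. idx x = i"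
begin

definition ker :: "'a set" where "ker = {x \<in> carrier G. idx x = 0}"

lemma n_pos: "n > 0"
  using idx_less[OF one_closed] by simp

lemma idx_one: "idx \<one> = 0"
proof -
  have "(idx \<one> + idx \<one>) mod n = (idx \<one> + 0) mod n"
    using idx_mult[of \<one> \<one>] idx_less[OF one_closed] by simp
  then have "idx \<one> mod n = 0 mod n"
    by (metis add.commute add.right_neutral mod_add_cong mod_add_left_eq nat_mod_eq_iff add_left_cancel cong_def cong_add_lcancel_nat)
  then show ?thesis using idx_less[OF one_closed] by simp
qed

lemma idx_inv_mult_eq_0_iff:
  assumes "x \<in> carrier G" "y \<in> carrier G"
  shows "idx (inv y \<otimes> x) = 0 \<longleftrightarrow> idx y = idx x"
proof
  assume "idx (inv y \<otimes> x) = 0"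
  then have "idx (y \<otimes> (inv y \<otimes> x)) = idx y mod n"
    using assms by (subst idx_mult) simp_all
  then show "idx y = idx x" using assms idx_less by (simp flip: m_assoc)
next
  assume eq: "idx y = idx x"
  have "idx (inv y \<otimes> x) = (idx (inv y) + idx y) mod n"
    using assms eq by (subst idx_mult) simp_all
  also have "\<dots> = idx (inv y \<otimes> y)" using assms by (subst idx_mult) simp_all
  finally show "idx (inv y \<otimes> x) = 0" using assms idx_one by simp
qed

lemma ker_subset: "ker \<subseteq> carrier G" by (auto simp: ker_def)

lemma finite_ker: "finite ker"
  using ker_subset finite_carrier by (rule finite_subset)

lemma card_ker_pos: "card ker > 0"
  using finite_ker idx_one by (auto simp: card_gt_0_iff ker_def)

lemma card_fiber:
  assumes "i < n"
  shows "card {x \<in> carrier G. idx x = i} = card ker"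
proof -
  obtain u where u: "u \<in> carrier G" "idx u = i" using idx_surj assms by blast
  have "bij_betw (\<lambda>x. u \<otimes> x) ker {x \<in> carrier G. idx x = i}"
  proof (rule bij_betw_byWitness[where f' = "\<lambda>x. inv u \<otimes> x"])
    show "(\<lambda>x. u \<otimes> x) ` ker \<subseteq> {x \<in> carrier G. idx x = i}"
      using u assms by (auto simp: ker_def idx_mult)
    show "(\<lambda>x. inv u \<otimes> x) ` {x \<in> carrier G. idx x = i} \<subseteq> ker"
      using u by (auto simp: ker_def idx_inv_mult_eq_0_iff)
  qed (use u in \<open>auto simp: ker_def simp flip: m_assoc\<close>)
  then show ?thesis by (simp add: bij_betw_same_card)
qed

lemma card_carrier: "card (carrier G) = n * card ker"
proof -
  have "card (carrier G) = card (\<Union>i<n. {x \<in> carrier G. idx x = i})"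
    using idx_less by (intro arg_cong[of _ _ card]) auto
  also have "\<dots> = (\<Sum>i<n. card {x \<in> carrier G. idx x = i})"
    using finite_carrier by (intro card_UN_disjoint) auto
  finally show ?thesis by (simp add: card_fiber)
qed

text \<open>The canonical representative, of degree below n, of the image of f under the
  homomorphism Q[G] -> Q[X]/(X^n - 1) that sends x to X^(idx x). Its coefficients are the sums of f
  over the fibres of \<open>idx\<close>.\<close>

definition index_poly :: "('a \<Rightarrow> rat) \<Rightarrow> rat poly" where
  "index_poly f = (\<Sum>x\<in>carrier G. monom (f x) (idx x))"

lemma coeff_index_poly: "coeff (index_poly f) i = (\<Sum>x | x \<in> carrier G \<and> idx x = i. f x)"
  using finite_carrier by (simp add: index_poly_def coeff_sum sum.inter_filter)

lemma degree_index_poly: "degree (index_poly f) < n"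
proof (rule degree_lessI)
  show "index_poly f \<noteq> 0 \<or> 0 < n" using n_pos by simp
  show "\<forall>k\<ge>n. coeff (index_poly f) k = 0"
    by (auto simp: coeff_index_poly dest!: idx_less intro!: sum.neutral)
qed

lemma index_poly_zero: "index_poly (\<lambda>x. 0) = 0"
  by (simp add: index_poly_def)

lemma index_poly_diff: "index_poly (\<lambda>x. f x - g x) = index_poly f - index_poly g"
  by (simp add: index_poly_def sum_subtractf flip: diff_monom)

text \<open>With i = q n + s the difference is -a X^s (X^(n q) - 1), and X^n - 1 divides X^(n q) -
  1.\<close>

lemma monom_mod_dvd: "(monom 1 n - 1 :: rat poly) dvd monom a (i mod n) - monom a i"
proof -
  have "monom 1 i = (monom 1 n ^ (i div n) * monom 1 (i mod n) :: rat poly)"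
    by (simp add: monom_power mult_monom)
  then have "monom 1 (i mod n) - monom 1 i = (- monom 1 (i mod n)) * (monom 1 n ^ (i div n) - 1 :: rat poly)"
    by (simp add: algebra_simps)
  also have "(monom 1 n - 1 :: rat poly) dvd \<dots>"
    by (metis dvd_mult power_diff_1_eq dvd_triv_left)
  finally have "(monom 1 n - 1 :: rat poly) dvd smult a (monom 1 (i mod n) - monom 1 i)"
    by (rule dvd_smult)
  then show ?thesis by (simp add: smult_diff_right smult_monom)
qed

text \<open>Equality can fail because \<open>idx\<close> reduces exponents modulo n while the
  product of polynomials does not; each pair (y, z) contributes a multiple of X^n - 1.\<close>

lemma index_poly_mult_dvd:
  "monom 1 n - 1 dvd index_poly (f \<otimes>\<^bsub>rat_group_algebra G\<^esub> g) - index_poly f * index_poly g"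
proof -
  have "index_poly (f \<otimes>\<^bsub>rat_group_algebra G\<^esub> g) =
      (\<Sum>y\<in>carrier G. \<Sum>z\<in>carrier G. monom (f y * g z) (idx (y \<otimes> z)))"
    unfolding index_poly_def by (rule sum_convolution) (simp_all add: add_monom)
  moreover have "index_poly f * index_poly g =
      (\<Sum>y\<in>carrier G. \<Sum>z\<in>carrier G. monom (f y * g z) (idx y + idx z))"
    by (simp add: index_poly_def sum_product mult_monom)
  ultimately have "index_poly (f \<otimes>\<^bsub>rat_group_algebra G\<^esub> g) - index_poly f * index_poly g =
      (\<Sum>y\<in>carrier G. \<Sum>z\<in>carrier G.
         monom (f y * g z) ((idx y + idx z) mod n) - monom (f y * g z) (idx y + idx z))"
    by (simp add: sum_subtractf idx_mult)
  also have "monom 1 n - 1 dvd \<dots>" by (intro dvd_sum monom_mod_dvd)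
  finally show ?thesis .
qed

text \<open>The idempotent of the kernel spreads the sum of f over each fibre evenly across that
  fibre. So the product depends on f only through \<open>index_poly f\<close>, which is the source
  of injectivity below.\<close>

lemma mult_trivial_idempotent_ker:
  assumes "x \<in> carrier G"
  shows "(f \<otimes>\<^bsub>rat_group_algebra G\<^esub> trivial_idempotent ker) x =
    coeff (index_poly f) (idx x) / of_nat (card ker)"
proof -
  have "(f \<otimes>\<^bsub>rat_group_algebra G\<^esub> trivial_idempotent ker) x =
      (\<Sum>y\<in>carrier G. if idx y = idx x then f y / of_nat (card ker) else 0)"
    unfolding mult_rat_group_algebra using assms
    by (auto simp: trivial_idempotent_def ker_def idx_inv_mult_eq_0_iff intro!: sum.cong)
  also have "\<dots> = (\<Sum>y | y \<in> carrier G \<and> idx y = idx x. f y / of_nat (card ker))"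
    using finite_carrier by (simp add: sum.inter_filter)
  finally show ?thesis by (simp add: coeff_index_poly sum_divide_distrib)
qed

text \<open>\<open>index_poly f\<close> has degree below n, so a multiple of X^n - 1 of this form is
  0.\<close>

lemma mult_trivial_idempotent_ker_eq_0:
  assumes "monom 1 n - 1 dvd index_poly f"
  shows "f \<otimes>\<^bsub>rat_group_algebra G\<^esub> trivial_idempotent ker = (\<lambda>x. 0)"
proof -
  have d: "degree (monom 1 n - 1 :: rat poly) = n"
    by (rule antisym, rule degree_le) (use n_pos in \<open>auto simp: coeff_1 intro!: le_degree\<close>)
  have "index_poly f = 0"
    using dvd_imp_degree_le[OF assms] degree_index_poly[of f] d by linarith
  then show ?thesis
    using mult_trivial_idempotent_ker[of _ f] by (auto simp: fun_eq_iff mult_rat_group_algebra)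
qed

lemma index_poly_trivial_idempotent_ker: "index_poly (trivial_idempotent ker) = 1"
proof (rule poly_eqI)
  fix i
  have "(\<Sum>x | x \<in> carrier G \<and> idx x = i. trivial_idempotent ker x) =
      (\<Sum>x | x \<in> carrier G \<and> idx x = i. if i = 0 then 1 / of_nat (card ker) else 0)"
    by (rule sum.cong) (auto simp: trivial_idempotent_def ker_def)
  also have "\<dots> = (if i = 0 then 1 else 0)"
    using card_fiber[of 0] n_pos card_ker_pos by simp
  finally show "coeff (index_poly (trivial_idempotent ker)) i = coeff 1 i"
    by (simp add: coeff_index_poly)
qed

lemma index_poly_trivial_idempotent_carrier:
  "index_poly (trivial_idempotent (carrier G)) = smult (1 / of_nat n) (geometric_sum_poly n)"
proof (rule poly_eqI)
  fix i
  have "(\<Sum>x | x \<in> carrier G \<and> idx x = i. trivial_idempotent (carrier G) x) =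
      (\<Sum>x | x \<in> carrier G \<and> idx x = i. 1 / of_nat (card (carrier G)))"
    by (rule sum.cong) (auto simp: trivial_idempotent_def)
  also have "\<dots> = (if i < n then 1 / of_nat n else 0)"
  proof (cases "i < n")
    case False
    then have empty: "{x \<in> carrier G. idx x = i} = {}" using idx_less by auto
    show ?thesis unfolding empty using False by simp
  qed (use card_ker_pos in \<open>simp add: card_fiber card_carrier\<close>)
  finally show "coeff (index_poly (trivial_idempotent (carrier G))) i =
      coeff (smult (1 / of_nat n) (geometric_sum_poly n)) i"
    by (simp add: coeff_index_poly coeff_geometric_sum_poly)
qed

lemma trivial_idempotent_ker_idem:
  "trivial_idempotent ker \<otimes>\<^bsub>rat_group_algebra G\<^esub> trivial_idempotent ker = trivial_idempotent ker"
proof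
  fix x show "(trivial_idempotent ker \<otimes>\<^bsub>rat_group_algebra G\<^esub> trivial_idempotent ker) x = trivial_idempotent ker x"
  proof (cases "x \<in> carrier G")
    case True
    then show ?thesis
      by (simp add: mult_trivial_idempotent_ker index_poly_trivial_idempotent_ker)
         (simp add: trivial_idempotent_def ker_def)
  qed (use ker_subset in \<open>auto simp: mult_rat_group_algebra trivial_idempotent_def\<close>)
qed

lemma trivial_idempotent_carrier_mult_ker:
  "trivial_idempotent (carrier G) \<otimes>\<^bsub>rat_group_algebra G\<^esub> trivial_idempotent ker = trivial_idempotent (carrier G)"
proof
  fix x show "(trivial_idempotent (carrier G) \<otimes>\<^bsub>rat_group_algebra G\<^esub> trivial_idempotent ker) x = trivial_idempotent (carrier G) x"
  proof (cases "x \<in> carrier G")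
    case True
    then show ?thesis
      by (simp add: mult_trivial_idempotent_ker index_poly_trivial_idempotent_carrier idx_less
         coeff_geometric_sum_poly)
         (simp add: trivial_idempotent_def card_carrier)
  qed (auto simp: mult_rat_group_algebra trivial_idempotent_def)
qed

end

text \<open>The cofactor \<Omega> is kept as a parameter because an idempotent is recognized by its
  residues modulo both factors. For prime n the pair is X - 1 and the geometric sum, in either role;
  for n = 1 it is X - 1 and 1.\<close>

locale cyclic_quotient_factor = cyclic_quotient +
  fixes \<Psi> \<Omega> :: "rat poly"
  assumes irreducible_factor: "irreducible \<Psi>"
    and factorization: "\<Psi> * \<Omega> = monom 1 n - 1"
begin

text \<open>On elements fixed by \<open>trivial_idempotent ker\<close> the map \<open>index_poly\<close> is injective modulo
  $X^n - 1$, so \<open>e\<close> is the element which is $1$ modulo \<open>\<Psi>\<close> and $0$ modulo \<open>\<Omega>\<close>.\<close>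

lemma primitive_central_idempotent_of_factor:
  assumes e: "e \<in> carrier (rat_group_algebra G)"
    and e_ker: "e \<otimes>\<^bsub>rat_group_algebra G\<^esub> trivial_idempotent ker = e"
    and e_\<Psi>: "\<Psi> dvd index_poly e - 1" and e_\<Omega>: "\<Omega> dvd index_poly e"
  shows "primitive_central_idempotent (rat_group_algebra G) e"
proof -
  interpret A: cring "rat_group_algebra G"
    using finite_carrier by (rule cring_rat_group_algebra)
  let ?A = "rat_group_algebra G" and ?h = "trivial_idempotent ker"
  have h: "?h \<in> carrier ?A" using ker_subset by (rule trivial_idempotent_closed)
  have zeroI: "f = \<zero>\<^bsub>?A\<^esub>" if f: "f \<in> carrier ?A" "f \<otimes>\<^bsub>?A\<^esub> ?h = f" "monom 1 n - 1 dvd index_poly f" for f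
    using mult_trivial_idempotent_ker_eq_0[OF f(3)] f(2) by (simp add: zero_rat_group_algebra)
  have idem: "e \<otimes>\<^bsub>?A\<^esub> e = e"
  proof -
    let ?f = "e \<otimes>\<^bsub>?A\<^esub> e \<ominus>\<^bsub>?A\<^esub> e"
    \<comment> \<open>Modulo one factor \<open>index_poly e\<close> is 1, modulo the other it is 0;
      hence its square minus itself vanishes modulo X^n - 1, and so does the image of e e -
      e.\<close>
    have "\<Psi> * \<Omega> dvd (index_poly e - 1) * index_poly e" using e_\<Psi> e_\<Omega> by (rule mult_dvd_mono)
    then have "monom 1 n - 1 dvd (index_poly (e \<otimes>\<^bsub>?A\<^esub> e) - index_poly e * index_poly e) + (index_poly e - 1) * index_poly e"
      unfolding factorization using index_poly_mult_dvd by (intro dvd_add)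
    also have "\<dots> = index_poly ?f"
      using e finite_carrier by (simp add: minus_rat_group_algebra index_poly_diff algebra_simps)
    finally have "monom 1 n - 1 dvd index_poly ?f" .
    moreover have "?f \<otimes>\<^bsub>?A\<^esub> ?h = ?f"
      using e h by (simp add: a_minus_def A.l_distr A.l_minus A.m_assoc e_ker)
    ultimately have "?f = \<zero>\<^bsub>?A\<^esub>" using e by (intro zeroI) auto
    then show ?thesis using e by simp
  qed
  have nunit: "\<not> \<Psi> dvd 1" using irreducible_factor by (rule irreducible_not_unit)
  have nz: "e \<noteq> \<zero>\<^bsub>?A\<^esub>"
    using e_\<Psi> nunit by (auto simp: zero_rat_group_algebra index_poly_zero dvd_minus_iff)
  have prime: "prime_elem \<Psi>" using irreducible_factor by (simp add: irreducible_imp_prime_elem)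
  \<comment> \<open>Multiples of e are already 0 modulo \<Omega>, so on them the residue modulo
    \<Psi> decides everything.\<close>
  have vanish: "f = \<zero>\<^bsub>?A\<^esub>"
    if f: "f \<in> carrier ?A" and ef: "e \<otimes>\<^bsub>?A\<^esub> f = f" and dvd: "\<Psi> dvd index_poly f" for f
  proof (rule zeroI[OF f])
    have "\<Omega> * \<Psi> dvd index_poly e * index_poly f" using e_\<Omega> dvd by (rule mult_dvd_mono)
    then have "monom 1 n - 1 dvd index_poly e * index_poly f"
      by (simp only: mult.commute[of \<Omega>] factorization)
    with index_poly_mult_dvd[of e f]
    have "monom 1 n - 1 dvd (index_poly (e \<otimes>\<^bsub>?A\<^esub> f) - index_poly e * index_poly f) + index_poly e * index_poly f"
      by (rule dvd_add)
    then show "monom 1 n - 1 dvd index_poly f" by (simp add: ef)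
    have "f \<otimes>\<^bsub>?A\<^esub> ?h = (e \<otimes>\<^bsub>?A\<^esub> ?h) \<otimes>\<^bsub>?A\<^esub> f"
      using e f h by (subst ef[symmetric]) (simp add: A.m_ac)
    then show "f \<otimes>\<^bsub>?A\<^esub> ?h = f" by (simp add: e_ker ef)
  qed
  have False
    if "central_idempotent ?A f" "central_idempotent ?A g" "f \<noteq> \<zero>\<^bsub>?A\<^esub>" "g \<noteq> \<zero>\<^bsub>?A\<^esub>"
      and fg: "f \<otimes>\<^bsub>?A\<^esub> g = \<zero>\<^bsub>?A\<^esub>" and efg: "e = f \<oplus>\<^bsub>?A\<^esub> g" for f g
  proof -
    have c: "f \<in> carrier ?A" "g \<in> carrier ?A" and ii: "f \<otimes>\<^bsub>?A\<^esub> f = f" "g \<otimes>\<^bsub>?A\<^esub> g = g"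
      using that(1,2) unfolding central_idempotent_def by blast+
    have gf: "g \<otimes>\<^bsub>?A\<^esub> f = \<zero>\<^bsub>?A\<^esub>" using A.m_comm[OF c] fg by simp
    have "e \<otimes>\<^bsub>?A\<^esub> f = f" "e \<otimes>\<^bsub>?A\<^esub> g = g"
      using c by (simp_all add: efg A.l_distr ii fg gf)
    then have "\<not> \<Psi> dvd index_poly f" "\<not> \<Psi> dvd index_poly g"
      using vanish c that(3,4) by blast+
    \<comment> \<open>Since f g = 0, the residues of f and g modulo \<Psi> would be zero divisors,
      while \<Psi> is prime.\<close>
    moreover have "\<Psi> dvd index_poly f * index_poly g"
    proof -
      have "\<Psi> dvd monom 1 n - 1" by (simp flip: factorization)
      also have "\<dots> dvd index_poly f * index_poly g"
        using index_poly_mult_dvd[of f g] by (simp add: fg zero_rat_group_algebra index_poly_zero)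
      finally show ?thesis .
    qed
    ultimately show False using prime by (simp add: prime_elem_dvd_mult_iff)
  qed
  moreover have "central_idempotent ?A e"
    using e idem A.m_comm unfolding central_idempotent_def by blast
  ultimately show ?thesis using nz unfolding primitive_central_idempotent_def by blast
qed

end

section \<open>Representations factoring through the cyclic quotient\<close>

text \<open>Identifies column vectors with polynomials of bounded degree, since
  \<open>pci_branches\<close> only admits representations on coordinate spaces. The inverse map is
  \<open>vec d (coeff q)\<close>.\<close>

definition poly_vec :: "rat vec \<Rightarrow> rat poly" where
  "poly_vec v = (\<Sum>i<dim_vec v. monom (v $ i) i)"

lemma coeff_poly_vec: "coeff (poly_vec v) i = (if i < dim_vec v then v $ i else 0)"
  by (simp add: poly_vec_def coeff_sum)

lemma poly_vec_add: "dim_vec v = dim_vec w \<Longrightarrow> poly_vec (v + w) = poly_vec v + poly_vec w"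
  by (rule poly_eqI) (auto simp: coeff_poly_vec)

lemma poly_vec_smult: "poly_vec (c \<cdot>\<^sub>v v) = smult c (poly_vec v)"
  by (rule poly_eqI) (auto simp: coeff_poly_vec)

lemma poly_vec_zero: "poly_vec (0\<^sub>v d) = 0"
  by (rule poly_eqI) (auto simp: coeff_poly_vec)

lemma poly_vec_inject: "dim_vec v = dim_vec w \<Longrightarrow> poly_vec v = poly_vec w \<longleftrightarrow> v = w"
  by (metis coeff_poly_vec eq_vecI)

lemma poly_vec_vec_coeff: "degree q < d \<Longrightarrow> poly_vec (vec d (coeff q)) = q"
  by (rule poly_eqI) (auto simp: coeff_poly_vec coeff_eq_0)

lemma degree_poly_vec: "0 < dim_vec v \<Longrightarrow> degree (poly_vec v) < dim_vec v"
  by (rule degree_lessI) (auto simp: coeff_poly_vec)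

context cyclic_quotient_factor
begin

text \<open>The representation on $\mathbb{Q}[X]/(\Psi)$ in which \<open>x\<close> acts as multiplication by
  $X^{\mathit{idx}\,x}$.\<close>

definition quotient_rep :: "'a \<Rightarrow> rat vec \<Rightarrow> rat vec" where
  "quotient_rep x v = vec (degree \<Psi>) (coeff ((monom 1 (idx x) * poly_vec v) mod \<Psi>))"

abbreviation "V\<^sub>\<Psi> \<equiv> module_vec TYPE(rat) (degree \<Psi>)"

lemma degree_pos: "degree \<Psi> > 0"
  using irreducible_factor unfolding irreducible_connect_field[symmetric] irreducible\<^sub>d_def by simp

lemma \<Psi>_dvd: "\<Psi> dvd monom 1 n - 1"
  by (simp flip: factorization)

lemma poly_vec_mod:
  assumes "v \<in> carrier_vec (degree \<Psi>)"
  shows "poly_vec v mod \<Psi> = poly_vec v"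
  using degree_poly_vec[of v] degree_pos assms by (intro mod_poly_less) auto

lemma quotient_rep_carrier: "quotient_rep x v \<in> carrier_vec (degree \<Psi>)"
  by (simp add: quotient_rep_def)

lemma poly_vec_reduce: "poly_vec (vec (degree \<Psi>) (coeff (q mod \<Psi>))) = q mod \<Psi>"
proof (rule poly_vec_vec_coeff)
  show "degree (q mod \<Psi>) < degree \<Psi>"
    using degree_mod_less[of \<Psi> q] degree_pos by fastforce
qed

lemma poly_vec_quotient_rep: "poly_vec (quotient_rep x v) = (monom 1 (idx x) * poly_vec v) mod \<Psi>"
  unfolding quotient_rep_def by (rule poly_vec_reduce)

lemma vec_eq_iff_poly_vec:
  assumes "v \<in> carrier_vec (degree \<Psi>)" "w \<in> carrier_vec (degree \<Psi>)"
  shows "v = w \<longleftrightarrow> poly_vec v = poly_vec w"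
  using assms by (simp add: poly_vec_inject)

text \<open>X^n is 1 modulo \<Psi>. This is why the reduced exponents delivered by
  \<open>idx\<close> define a genuine action.\<close>

lemma monom_mod_cong: "monom a (i mod n) mod \<Psi> = monom a i mod \<Psi>"
  using dvd_trans[OF \<Psi>_dvd monom_mod_dvd] by (simp add: mod_eq_dvd_iff)

lemma quotient_rep_linear:
  shows "v \<in> carrier_vec (degree \<Psi>) \<Longrightarrow> w \<in> carrier_vec (degree \<Psi>) \<Longrightarrow>
      quotient_rep x (v + w) = quotient_rep x v + quotient_rep x w"
    and "v \<in> carrier_vec (degree \<Psi>) \<Longrightarrow> quotient_rep x (c \<cdot>\<^sub>v v) = c \<cdot>\<^sub>v quotient_rep x v"
  by (simp_all add: quotient_rep_carrier vec_eq_iff_poly_vec poly_vec_quotient_rep poly_vec_add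
      poly_vec_smult carrier_vecD[OF quotient_rep_carrier] distrib_left poly_mod_add_left mod_smult_left)

lemma rat_rep_quotient_rep: "rat_rep G V\<^sub>\<Psi> quotient_rep"
  unfolding rat_rep_def
proof (intro conjI ballI)
  show vs: "vectorspace rat_field V\<^sub>\<Psi>" by (rule vec_vs)
  fix x assume x: "x \<in> carrier G"
  show "linear_map rat_field V\<^sub>\<Psi> V\<^sub>\<Psi> (quotient_rep x)"
    unfolding linear_map_def mod_hom_def mod_hom_axioms_def LinearCombinations.module_hom_def
    using vs by (auto simp: vectorspace_def module_vec_simps quotient_rep_carrier quotient_rep_linear)
next
  fix v assume "v \<in> carrier V\<^sub>\<Psi>"
  then have v: "v \<in> carrier_vec (degree \<Psi>)" by (simp add: module_vec_simps)
  then show "quotient_rep \<one> v = v"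
    by (simp add: quotient_rep_carrier vec_eq_iff_poly_vec poly_vec_quotient_rep idx_one poly_vec_mod)
  fix x y assume xy: "x \<in> carrier G" "y \<in> carrier G"
  have "(monom 1 (idx (x \<otimes> y)) * poly_vec v) mod \<Psi> = (monom 1 (idx x + idx y) * poly_vec v) mod \<Psi>"
    using mod_mult_cong[OF monom_mod_cong refl] xy by (simp add: idx_mult)
  also have "\<dots> = (monom 1 (idx x) * ((monom 1 (idx y) * poly_vec v) mod \<Psi>)) mod \<Psi>"
    using mult_monom[of "1 :: rat" "idx x" 1 "idx y", symmetric] by (simp add: mod_mult_right_eq mult.assoc)
  finally show "quotient_rep (x \<otimes> y) v = quotient_rep x (quotient_rep y v)"
    by (simp add: quotient_rep_carrier vec_eq_iff_poly_vec poly_vec_quotient_rep)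
qed

text \<open>The linear extension of the action factors through Q[X]/(X^n - 1). It follows that f
  acts as the identity once \<open>index_poly f\<close> is 1 modulo \<Psi>.\<close>

lemma algebra_action_quotient_rep:
  assumes v: "v \<in> carrier_vec (degree \<Psi>)"
  shows "poly_vec (algebra_action G V\<^sub>\<Psi> quotient_rep f v) = (index_poly f * poly_vec v) mod \<Psi>"
proof -
  interpret W: vec_space "TYPE(rat)" "degree \<Psi>" .
  define F where "F A = finsum V\<^sub>\<Psi> (\<lambda>x. f x \<cdot>\<^sub>v quotient_rep x v) A" for A
  \<comment> \<open>The dimension is part of the induction because \<open>poly_vec_add\<close> needs
    summands of equal dimension.\<close>
  have "dim_vec (F A) = degree \<Psi> \<and>
      poly_vec (F A) = ((\<Sum>x\<in>A. monom (f x) (idx x)) * poly_vec v) mod \<Psi>" if "finite A" for A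
    using that
  proof induction
    case empty
    then show ?case by (simp add: F_def poly_vec_zero)
  next
    case (insert x A)
    have "F (insert x A) = f x \<cdot>\<^sub>v quotient_rep x v + F A"
      unfolding F_def using insert by (subst W.finsum_insert) (auto simp: quotient_rep_carrier)
    moreover have "poly_vec (f x \<cdot>\<^sub>v quotient_rep x v) = (monom (f x) (idx x) * poly_vec v) mod \<Psi>"
      by (simp add: poly_vec_smult poly_vec_quotient_rep mod_smult_left[symmetric] smult_monom
          flip: mult_smult_left)
    ultimately show ?case
      using insert carrier_vecD[OF quotient_rep_carrier]
      by (simp add: poly_vec_add distrib_right poly_mod_add_left)
  qed
  moreover have "algebra_action G V\<^sub>\<Psi> quotient_rep f v = F (carrier G)"
    by (simp add: algebra_action_def F_def)
  ultimately show ?thesis using finite_carrier by (simp add: index_poly_def)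
qed

lemma algebra_action_quotient_rep_id:
  assumes "\<Psi> dvd index_poly f - 1" and v: "v \<in> carrier V\<^sub>\<Psi>"
  shows "algebra_action G V\<^sub>\<Psi> quotient_rep f v = v"
proof -
  interpret W: vec_space "TYPE(rat)" "degree \<Psi>" .
  have v': "v \<in> carrier_vec (degree \<Psi>)" using v by (simp add: module_vec_simps)
  have "\<Psi> dvd (index_poly f - 1) * poly_vec v" using assms(1) by (rule dvd_mult2)
  then have "(index_poly f * poly_vec v) mod \<Psi> = poly_vec v mod \<Psi>"
    by (simp add: mod_eq_dvd_iff algebra_simps)
  moreover have "algebra_action G V\<^sub>\<Psi> quotient_rep f v \<in> carrier_vec (degree \<Psi>)"
    unfolding algebra_action_def by (rule W.finsum_closed) (auto simp: quotient_rep_carrier)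
  ultimately show ?thesis
    using v' by (simp add: vec_eq_iff_poly_vec algebra_action_quotient_rep poly_vec_mod)
qed

text \<open>A nonzero vector is a nonzero polynomial of degree below that of the irreducible \<Psi>,
  hence coprime to it; a is its Bezout coefficient.\<close>

lemma ex_inverse_mod:
  assumes "v \<in> carrier_vec (degree \<Psi>)" "v \<noteq> 0\<^sub>v (degree \<Psi>)"
  obtains a where "(a * poly_vec v) mod \<Psi> = 1"
proof -
  have nz: "poly_vec v \<noteq> 0"
    using assms by (metis poly_vec_zero vec_eq_iff_poly_vec zero_carrier_vec)
  have "\<not> \<Psi> dvd poly_vec v"
    using poly_vec_mod[OF assms(1)] nz by (auto simp: dvd_eq_mod_eq_0)
  then have "algebraic_semidom_class.coprime \<Psi> (poly_vec v)"
    by (rule prime_elem_imp_coprime[OF irreducible_imp_prime_elem[OF irreducible_factor]])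
  then obtain a b where "a * poly_vec v + b * \<Psi> = 1"
    using bezout_coefficients_fst_snd[of "poly_vec v" \<Psi>]
    by (metis coprime_imp_gcd_eq_1 gcd.commute)
  then have "a * poly_vec v - 1 = \<Psi> * (- b)" by (simp add: algebra_simps)
  then have "(a * poly_vec v) mod \<Psi> = 1 mod \<Psi>" by (simp add: mod_eq_dvd_iff)
  also have "1 mod \<Psi> = 1" using degree_pos by (intro mod_poly_less) simp
  finally show thesis by (rule that)
qed

text \<open>An invariant subspace is an ideal of the field Q[X]/(\<Psi>): an element of index 1 acts
  as multiplication by X. A nonzero ideal contains a unit and is therefore everything.\<close>

lemma irreducible_quotient_rep: "irreducible_rat_rep G V\<^sub>\<Psi> quotient_rep"
  unfolding irreducible_rat_rep_def
proof (intro conjI allI impI)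
  show "rat_rep G V\<^sub>\<Psi> quotient_rep" by (rule rat_rep_quotient_rep)
  show "carrier V\<^sub>\<Psi> \<noteq> {\<zero>\<^bsub>V\<^sub>\<Psi>\<^esub>}"
  proof
    assume "carrier V\<^sub>\<Psi> = {\<zero>\<^bsub>V\<^sub>\<Psi>\<^esub>}"
    then have "vec (degree \<Psi>) (\<lambda>_. 1) = (0\<^sub>v (degree \<Psi>) :: rat vec)"
      unfolding module_vec_simps using vec_carrier by blast
    then have "vec (degree \<Psi>) (\<lambda>_. 1) $ 0 = (0\<^sub>v (degree \<Psi>) :: rat vec) $ 0" by simp
    then show False using degree_pos by simp
  qed
  fix W assume W: "VectorSpace.subspace rat_field W V\<^sub>\<Psi> \<and> (\<forall>g\<in>carrier G. quotient_rep g ` W \<subseteq> W)"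
  then interpret W: LinearCombinations.submodule rat_field W V\<^sub>\<Psi> by (simp add: VectorSpace.subspace_def)
  have W_sub: "W \<subseteq> carrier_vec (degree \<Psi>)" using W.subset by (simp add: module_vec_simps)
  have W_add: "v + w \<in> W" if "v \<in> W" "w \<in> W" for v w
    using W.m_closed[OF that] by (simp add: module_vec_simps)
  have W_zero: "0\<^sub>v (degree \<Psi>) \<in> W" using W.zero_closed by (simp add: module_vec_simps)
  have W_smult: "c \<cdot>\<^sub>v v \<in> W" if "v \<in> W" for c v
    using W.smult_closed[of c v] that by (simp add: module_vec_simps class_ring_simps)
  have "W = carrier_vec (degree \<Psi>)" if "W \<noteq> {0\<^sub>v (degree \<Psi>)}"
  proof -
    from that W_zero obtain w where w: "w \<in> W" "w \<noteq> 0\<^sub>v (degree \<Psi>)" by blast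
    have wc: "w \<in> carrier_vec (degree \<Psi>)" using w W_sub by blast
    obtain a where a: "(a * poly_vec w) mod \<Psi> = 1" using ex_inverse_mod[OF wc w(2)] .
    \<comment> \<open>The residue \<open>1 mod n\<close> also covers n = 1, where it is 0; there X
      is 1 modulo \<Psi>, so u still acts as multiplication by X.\<close>
    obtain u where u: "u \<in> carrier G" "idx u = 1 mod n" using idx_surj[OF mod_less_divisor[OF n_pos], of 1] by blast
    \<comment> \<open>Horner's scheme: \<open>pCons b c\<close> is b + X c, so one application of u
      and one linear combination suffice per coefficient.\<close>
    have mult_closed: "vec (degree \<Psi>) (coeff ((c * poly_vec w) mod \<Psi>)) \<in> W" for c
    proof (induction c)
      case 0
      then show ?case using W_zero by (simp add: zero_vec_def)
    next
      case (pCons b c)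
      let ?v = "vec (degree \<Psi>) (coeff ((c * poly_vec w) mod \<Psi>))"
      have "b \<cdot>\<^sub>v w + quotient_rep u ?v \<in> W" using pCons W u(1) w(1) W_add W_smult by blast
      moreover have "b \<cdot>\<^sub>v w + quotient_rep u ?v
          = vec (degree \<Psi>) (coeff ((pCons b c * poly_vec w) mod \<Psi>))"
      proof -
        have "(monom 1 (1 mod n) * (c * poly_vec w mod \<Psi>)) mod \<Psi> = (monom 1 1 * (c * poly_vec w)) mod \<Psi>"
          unfolding mod_mult_right_eq by (rule mod_mult_cong[OF monom_mod_cong refl])
        moreover have "pCons b c * poly_vec w = smult b (poly_vec w) + monom 1 1 * (c * poly_vec w)"
          by (simp add: monom_Suc)
        ultimately have "(pCons b c * poly_vec w) mod \<Psi> =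
            smult b (poly_vec w) + (monom 1 (1 mod n) * (c * poly_vec w mod \<Psi>)) mod \<Psi>"
          using wc by (simp only: poly_mod_add_left mod_smult_left poly_vec_mod)
        moreover have "poly_vec (b \<cdot>\<^sub>v w + quotient_rep u ?v) =
            smult b (poly_vec w) + (monom 1 (1 mod n) * (c * poly_vec w mod \<Psi>)) mod \<Psi>"
          using wc carrier_vecD[OF quotient_rep_carrier] unfolding u(2)[symmetric]
          by (subst poly_vec_add) (simp_all add: poly_vec_smult poly_vec_quotient_rep poly_vec_reduce)
        ultimately have "poly_vec (b \<cdot>\<^sub>v w + quotient_rep u ?v) =
            poly_vec (vec (degree \<Psi>) (coeff ((pCons b c * poly_vec w) mod \<Psi>)))"
          unfolding poly_vec_reduce by simp
        then show ?thesis
          using carrier_vecD[OF quotient_rep_carrier] by (subst (asm) poly_vec_inject) simp_all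
      qed
      ultimately show ?case by simp
    qed
    have "v \<in> W" if v: "v \<in> carrier_vec (degree \<Psi>)" for v
    proof -
      \<comment> \<open>As a inverts w, the multiplier v a carries w to v.\<close>
      have "((poly_vec v * a) * poly_vec w) mod \<Psi> = (poly_vec v * (a * poly_vec w mod \<Psi>)) mod \<Psi>"
        by (simp add: mod_mult_right_eq mult.assoc)
      also have "\<dots> = poly_vec v" using v by (simp add: a poly_vec_mod)
      finally have "vec (degree \<Psi>) (coeff (((poly_vec v * a) * poly_vec w) mod \<Psi>)) = v"
        using v by (auto simp: coeff_poly_vec)
      then show ?thesis using mult_closed[of "poly_vec v * a"] by simp
    qed
    then show ?thesis using W_sub by blast
  qed
  then show "W = {\<zero>\<^bsub>V\<^sub>\<Psi>\<^esub>} \<or> W = carrier V\<^sub>\<Psi>" by (auto simp: module_vec_simps)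
qed

lemma associated_irrep_quotient_rep:
  assumes "\<Psi> dvd index_poly f - 1"
  shows "associated_irrep G f V\<^sub>\<Psi> quotient_rep"
  using assms irreducible_quotient_rep algebra_action_quotient_rep_id
  by (simp add: associated_irrep_def)

end

section \<open>Occurrence in the induced representation\<close>

text \<open>\<open>linear_map\<close> requires its codomain to be a vector space. With H acting
  trivially, equivariance turns into invariance under left translation by H, and all laws hold
  pointwise; \<open>restrict\<close> keeps the functions extensional.\<close>

lemma (in group) vectorspace_induced_space:
  assumes H: "H \<subseteq> carrier G"
    and triv: "\<And>h v. h \<in> H \<Longrightarrow> v \<in> carrier_vec k \<Longrightarrow> \<eta> h v = v"
  shows "vectorspace rat_field (induced_space G H (module_vec TYPE(rat) k) \<eta>)"
proof -
  let ?I = "induced_space G H (module_vec TYPE(rat) k) \<eta>"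
  let ?C = "{f :: 'a \<Rightarrow> rat vec. f \<in> carrier G \<rightarrow>\<^sub>E carrier_vec k \<and> (\<forall>h\<in>H. \<forall>x\<in>carrier G. f (h \<otimes> x) = f x)}"
  have C: "carrier ?I = ?C"
  proof -
    have "(\<forall>h\<in>H. \<forall>x\<in>carrier G. f (h \<otimes> x) = \<eta> h (f x)) \<longleftrightarrow>
        (\<forall>h\<in>H. \<forall>x\<in>carrier G. f (h \<otimes> x) = f x)" if "f \<in> carrier G \<rightarrow>\<^sub>E carrier_vec k" for f
      using triv PiE_mem[OF that] by simp
    then show ?thesis by (auto simp: induced_space_def module_vec_simps)
  qed
  have ops: "zero ?I = (\<lambda>x\<in>carrier G. 0\<^sub>v k)" "add ?I = (\<lambda>f g. \<lambda>x\<in>carrier G. f x + g x)"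
    "module.smult ?I = (\<lambda>c f. \<lambda>x\<in>carrier G. c \<cdot>\<^sub>v f x)"
    by (simp_all add: induced_space_def module_vec_simps)
  have val: "f x \<in> carrier_vec k" if "f \<in> ?C" "x \<in> carrier G" for f x
    using that by auto
  have eqI: "f = g" if "f \<in> extensional (carrier G)" "g \<in> extensional (carrier G)"
    "\<And>x. x \<in> carrier G \<Longrightarrow> f x = g x" for f g :: "'a \<Rightarrow> rat vec"
    using that by (rule extensionalityI)
  have ext: "f \<in> extensional (carrier G)" if "f \<in> ?C" for f
    using that by (auto simp: PiE_def)
  have memI: "(\<lambda>x\<in>carrier G. F x) \<in> ?C"
    if "\<And>x. x \<in> carrier G \<Longrightarrow> F x \<in> carrier_vec k"
      "\<And>h x. h \<in> H \<Longrightarrow> x \<in> carrier G \<Longrightarrow> F (h \<otimes> x) = F x" for F :: "'a \<Rightarrow> rat vec"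
    using that subsetD[OF H] by auto
  have inv: "f (h \<otimes> x) = f x" if "f \<in> ?C" "h \<in> H" "x \<in> carrier G" for f h x
    using that by blast
  have "abelian_group ?I"
  proof (rule abelian_groupI, unfold C ops)
    fix f g assume f: "f \<in> ?C" and g: "g \<in> ?C"
    show "(\<lambda>x\<in>carrier G. f x + g x) \<in> ?C"
      by (rule memI) (simp_all add: val[OF f] val[OF g] inv[OF f] inv[OF g])
    show "(\<lambda>x\<in>carrier G. f x + g x) = (\<lambda>x\<in>carrier G. g x + f x)"
      by (rule restrict_ext) (rule comm_add_vec[OF val[OF f] val[OF g]])
    fix k' assume k': "k' \<in> ?C"
    show "(\<lambda>x\<in>carrier G. (\<lambda>x\<in>carrier G. f x + g x) x + k' x) =
        (\<lambda>x\<in>carrier G. f x + (\<lambda>x\<in>carrier G. g x + k' x) x)"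
      by (rule restrict_ext) (simp add: assoc_add_vec[OF val[OF f] val[OF g] val[OF k']])
  next
    show "(\<lambda>x\<in>carrier G. 0\<^sub>v k) \<in> ?C" by (rule memI) simp_all
  next
    fix f assume f: "f \<in> ?C"
    show "(\<lambda>x\<in>carrier G. (\<lambda>x\<in>carrier G. 0\<^sub>v k) x + f x) = f"
      by (rule eqI) (simp_all add: ext[OF f] val[OF f])
    show "\<exists>g\<in>?C. (\<lambda>x\<in>carrier G. g x + f x) = (\<lambda>x\<in>carrier G. 0\<^sub>v k)"
    proof (rule bexI)
      show "(\<lambda>x\<in>carrier G. - f x) \<in> ?C"
        by (rule memI) (simp_all add: val[OF f] inv[OF f])
      show "(\<lambda>x\<in>carrier G. (\<lambda>x\<in>carrier G. - f x) x + f x) = (\<lambda>x\<in>carrier G. 0\<^sub>v k)"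
        by (rule restrict_ext) (simp add: uminus_l_inv_vec[OF val[OF f]])
    qed
  qed
  moreover have "cring rat_field"
    using class_field[where 'a = rat] unfolding class_field_def by (simp add: field_def domain_def)
  ultimately have "Module.module rat_field ?I"
  proof (intro moduleI, unfold C ops class_ring_simps)
    fix a f assume f: "f \<in> ?C"
    show "(\<lambda>x\<in>carrier G. a \<cdot>\<^sub>v f x) \<in> ?C"
      by (rule memI) (simp_all add: val[OF f] inv[OF f])
    fix b
    show "(\<lambda>x\<in>carrier G. (a + b) \<cdot>\<^sub>v f x) =
        (\<lambda>x\<in>carrier G. (\<lambda>x\<in>carrier G. a \<cdot>\<^sub>v f x) x + (\<lambda>x\<in>carrier G. b \<cdot>\<^sub>v f x) x)"
      by (rule restrict_ext) (simp add: add_smult_distrib_vec)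
    show "(\<lambda>x\<in>carrier G. (a * b) \<cdot>\<^sub>v f x) = (\<lambda>x\<in>carrier G. a \<cdot>\<^sub>v (\<lambda>x\<in>carrier G. b \<cdot>\<^sub>v f x) x)"
      by (rule restrict_ext) (simp add: smult_smult_assoc)
  next
    fix a f g assume f: "f \<in> ?C" and g: "g \<in> ?C"
    show "(\<lambda>x\<in>carrier G. a \<cdot>\<^sub>v (\<lambda>x\<in>carrier G. f x + g x) x) =
        (\<lambda>x\<in>carrier G. (\<lambda>x\<in>carrier G. a \<cdot>\<^sub>v f x) x + (\<lambda>x\<in>carrier G. a \<cdot>\<^sub>v g x) x)"
      by (rule restrict_ext) (simp add: smult_add_distrib_vec[OF val[OF f] val[OF g]])
  next
    fix f assume f: "f \<in> ?C"
    show "(\<lambda>x\<in>carrier G. 1 \<cdot>\<^sub>v f x) = f"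
      by (rule eqI) (simp_all add: ext[OF f] val[OF f])
  qed
  then show ?thesis
    using class_field[where 'a = rat] unfolding vectorspace_def class_field_def by blast
qed

context cyclic_quotient_factor
begin

text \<open>The functional used is the constant coefficient of the reduced representative. If it
  vanishes on X^i v for every i, it vanishes on all multiples of v by linearity; for v nonzero one
  of these is 1, whose constant coefficient is not 0. Hence T is injective.\<close>

lemma quotient_rep_occurs_in_induced:
  assumes triv: "\<And>h v. h \<in> ker \<Longrightarrow> v \<in> carrier_vec 1 \<Longrightarrow> \<eta> h v = v"
  shows "occurs_in G V\<^sub>\<Psi> quotient_rep (induced_space G ker (module_vec TYPE(rat) 1) \<eta>) (induced_action G)"
proof -
  let ?I = "induced_space G ker (module_vec TYPE(rat) 1) \<eta>"
  define T where "T v = (\<lambda>x\<in>carrier G. vec 1 (\<lambda>_. coeff ((monom 1 (idx x) * poly_vec v) mod \<Psi>) 0))" for v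
  have T_closed: "T v \<in> carrier ?I" for v
    using ker_subset
    by (auto simp: induced_space_def module_vec_simps T_def triv idx_mult ker_def idx_less)
  have T_add: "T (v + w) = (\<lambda>x\<in>carrier G. T v x + T w x)"
    if "v \<in> carrier_vec (degree \<Psi>)" "w \<in> carrier_vec (degree \<Psi>)" for v w
    unfolding T_def using that
    by (intro restrict_ext eq_vecI) (auto simp: poly_vec_add distrib_left poly_mod_add_left)
  have T_smult: "T (c \<cdot>\<^sub>v v) = (\<lambda>x\<in>carrier G. c \<cdot>\<^sub>v T v x)" for c v
    unfolding T_def
    by (intro restrict_ext eq_vecI) (auto simp: poly_vec_smult mod_smult_left)
  have hom: "T \<in> LinearCombinations.module_hom rat_field V\<^sub>\<Psi> ?I"
    unfolding LinearCombinations.module_hom_def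
    using T_closed by (auto simp: module_vec_simps T_add T_smult) (auto simp: induced_space_def module_vec_simps)
  have vs: "vectorspace rat_field ?I" using ker_subset triv by (rule vectorspace_induced_space)
  have lin: "linear_map rat_field V\<^sub>\<Psi> ?I T"
    unfolding linear_map_def mod_hom_def mod_hom_axioms_def
    using vs vec_vs hom by (auto simp: vectorspace_def)
  have zero: "v = 0\<^sub>v (degree \<Psi>)"
    if v: "v \<in> carrier_vec (degree \<Psi>)" and Tv: "\<And>x. x \<in> carrier G \<Longrightarrow> T v x = 0\<^sub>v 1" for v
  proof (rule ccontr)
    assume "v \<noteq> 0\<^sub>v (degree \<Psi>)"
    with v obtain a where a: "(a * poly_vec v) mod \<Psi> = 1" by (rule ex_inverse_mod)
    have monom0: "coeff ((monom 1 i * poly_vec v) mod \<Psi>) 0 = 0" for i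
    proof -
      \<comment> \<open>Surjectivity of \<open>idx\<close> turns vanishing on the group into
        vanishing for every exponent, up to reduction modulo n.\<close>
      obtain x where x: "x \<in> carrier G" "idx x = i mod n"
        using idx_surj[OF mod_less_divisor[OF n_pos]] by blast
      have "T v x $ 0 = 0" using Tv[OF x(1)] by simp
      then have "coeff ((monom 1 (i mod n) * poly_vec v) mod \<Psi>) 0 = 0"
        using x by (simp add: T_def)
      then show ?thesis using mod_mult_cong[OF monom_mod_cong refl] by metis
    qed
    have "coeff ((c * poly_vec v) mod \<Psi>) 0 = 0" for c
    proof -
      have "c * poly_vec v = (\<Sum>i\<le>degree c. smult (coeff c i) (monom 1 i * poly_vec v))"
        by (subst poly_as_sum_of_monoms[of c, symmetric])
           (simp add: sum_distrib_right smult_monom flip: mult_smult_left)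
      moreover have "(\<Sum>i\<in>A. F i) mod \<Psi> = (\<Sum>i\<in>A. F i mod \<Psi>)" for A :: "nat set" and F
        by (induction A rule: infinite_finite_induct) (simp_all add: poly_mod_add_left)
      ultimately show ?thesis by (simp add: mod_smult_left coeff_sum monom0)
    qed
    from this[of a] show False unfolding a by simp
  qed
  have "inj_on T (carrier V\<^sub>\<Psi>)"
  proof (rule inj_onI)
    fix v w assume "v \<in> carrier V\<^sub>\<Psi>" "w \<in> carrier V\<^sub>\<Psi>" and eq: "T v = T w"
    then have vw: "v \<in> carrier_vec (degree \<Psi>)" "w \<in> carrier_vec (degree \<Psi>)"
      by (simp_all add: module_vec_simps)
    have "v + (-1) \<cdot>\<^sub>v w = 0\<^sub>v (degree \<Psi>)"
    proof (rule zero)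
      fix x assume x: "x \<in> carrier G"
      have "T (v + (-1) \<cdot>\<^sub>v w) x = T v x + (-1) \<cdot>\<^sub>v T v x"
        using vw x by (simp add: T_add T_smult eq)
      also have "\<dots> = 0\<^sub>v 1" using x by (intro eq_vecI) (auto simp: T_def)
      finally show "T (v + (-1) \<cdot>\<^sub>v w) x = 0\<^sub>v 1" .
    qed (use vw in auto)
    then have "(v + (-1) \<cdot>\<^sub>v w) $ i = 0" if "i < degree \<Psi>" for i using that by simp
    then show "v = w" using vw by (intro eq_vecI) auto
  qed
  moreover have "T (quotient_rep g v) = induced_action G g (T v)" if g: "g \<in> carrier G" for g v
  proof -
    have "(monom 1 (idx x) * poly_vec (quotient_rep g v)) mod \<Psi> = (monom 1 (idx (x \<otimes> g)) * poly_vec v) mod \<Psi>"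
      if x: "x \<in> carrier G" for x
    proof -
      have "(monom 1 (idx (x \<otimes> g)) * poly_vec v) mod \<Psi> = (monom 1 (idx x + idx g) * poly_vec v) mod \<Psi>"
        using mod_mult_cong[OF monom_mod_cong refl] x g by (simp add: idx_mult)
      then show ?thesis
        using mult_monom[of "1 :: rat" "idx x" 1 "idx g", symmetric]
        by (simp add: poly_vec_quotient_rep mod_mult_right_eq mult.assoc)
    qed
    then show ?thesis unfolding T_def induced_action_def
      using g by (intro restrict_ext) simp
  qed
  ultimately show ?thesis using lin unfolding occurs_in_def by blast
qed

end

section \<open>From idempotents acting as the identity to trivial group actions, and back\<close>

lemma (in mod_hom) hom_finsum:
  assumes "F \<in> A \<rightarrow> carrier M"
  shows "f (finsum M F A) = finsum N (\<lambda>x. f (F x)) A"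
  using assms
proof (induction A rule: infinite_finite_induct)
  case (insert x A)
  then have "F \<in> A \<rightarrow> carrier M" "F x \<in> carrier M" by auto
  then show ?case
    using insert by (simp add: M.M.finsum_insert N.M.finsum_insert M.M.finsum_closed Pi_def)
qed simp_all

text \<open>By assumption v equals the average of its translates, and applying h only permutes the
  terms of that average.\<close>

lemma (in group) trivial_action_of_trivial_idempotent:
  assumes rep: "rat_rep G V \<eta>"
    and id: "\<And>v. v \<in> carrier V \<Longrightarrow> algebra_action G V \<eta> (trivial_idempotent (carrier G)) v = v"
    and h: "h \<in> carrier G" and v: "v \<in> carrier V"
  shows "\<eta> h v = v"
proof -
  have lin: "linear_map rat_field V V (\<eta> g)" if "g \<in> carrier G" for g
    using rep that by (simp add: rat_rep_def)
  interpret AV: vectorspace rat_field V using rep by (simp add: rat_rep_def)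
  interpret T: linear_map rat_field V V "\<eta> h" using h by (rule lin)
  have closed: "\<eta> g v \<in> carrier V" if "g \<in> carrier G" for g
  proof -
    interpret L: linear_map rat_field V V "\<eta> g" using that by (rule lin)
    show ?thesis using v by (rule L.f_im)
  qed
  define c :: rat where "c = 1 / of_nat (card (carrier G))"
  let ?F = "\<lambda>g. c \<odot>\<^bsub>V\<^esub> \<eta> g v"
  have F: "?F \<in> carrier G \<rightarrow> carrier V" using closed by (auto simp: class_ring_simps)
  have avg: "finsum V ?F (carrier G) = v"
  proof -
    have "finsum V ?F (carrier G) = algebra_action G V \<eta> (trivial_idempotent (carrier G)) v"
      unfolding algebra_action_def
      by (rule AV.finsum_cong'[OF refl]) (use F in \<open>auto simp: trivial_idempotent_def c_def\<close>)
    then show ?thesis using id[OF v] by simp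
  qed
  have "\<eta> h v = finsum V (\<lambda>g. \<eta> h (?F g)) (carrier G)"
    using T.hom_finsum[OF F] by (simp add: avg)
  also have "\<dots> = finsum V (\<lambda>g. ?F (h \<otimes> g)) (carrier G)"
  proof (rule AV.finsum_cong')
    fix g assume g: "g \<in> carrier G"
    have "\<eta> h (?F g) = c \<odot>\<^bsub>V\<^esub> \<eta> h (\<eta> g v)"
      using closed[OF g] by (intro T.f_smult) (auto simp: class_ring_simps)
    then show "\<eta> h (?F g) = ?F (h \<otimes> g)" using rep g h v by (simp add: rat_rep_def)
  qed (use h F in auto)
  also have "\<dots> = finsum V ?F ((\<lambda>g. h \<otimes> g) ` carrier G)"
    using h F by (intro AV.add.finprod_reindex[symmetric]) (auto simp: surj_const_mult inj_on_cmult)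
  also have "\<dots> = v" using h by (simp add: surj_const_mult avg)
  finally show ?thesis .
qed

text \<open>The group is commutative, so right translation by h is left translation, which
  equivariance turns into the trivial action of h on values. Thus h fixes \<open>T w\<close>, and
  injectivity of T brings this back to w.\<close>

lemma trivial_action_of_occurs_in_induced:
  assumes occ: "occurs_in G W \<theta> (induced_space G H V \<eta>) (induced_action G)"
    and grp: "comm_group G" and rep: "rat_rep G W \<theta>" and H: "H \<subseteq> carrier G"
    and triv: "\<And>h v. h \<in> H \<Longrightarrow> v \<in> carrier V \<Longrightarrow> \<eta> h v = v"
    and h: "h \<in> H" and w: "w \<in> carrier W"
  shows "\<theta> h w = w"
proof -
  interpret comm_group G by fact
  obtain T where lin: "linear_map rat_field W (induced_space G H V \<eta>) T"
    and inj: "inj_on T (carrier W)"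
    and T: "\<And>g w. g \<in> carrier G \<Longrightarrow> w \<in> carrier W \<Longrightarrow> T (\<theta> g w) = induced_action G g (T w)"
    using occ unfolding occurs_in_def by blast
  interpret T: linear_map rat_field W "induced_space G H V \<eta>" T by fact
  have hG: "h \<in> carrier G" using h H by blast
  interpret L: linear_map rat_field W W "\<theta> h" using rep hG by (simp add: rat_rep_def)
  have Tw: "T w \<in> carrier G \<rightarrow>\<^sub>E carrier V"
    and eqv: "\<And>x. x \<in> carrier G \<Longrightarrow> T w (h \<otimes>\<^bsub>G\<^esub> x) = \<eta> h (T w x)"
    using T.f_im[OF w] h unfolding induced_space_def by auto
  have "T (\<theta> h w) = T w"
    unfolding T[OF hG w] induced_action_def
  proof (rule extensionalityI)
    show "T w \<in> extensional (carrier G)" using Tw by (simp add: PiE_def)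
    fix x assume x: "x \<in> carrier G"
    have "T w (x \<otimes>\<^bsub>G\<^esub> h) = \<eta> h (T w x)" using eqv[OF x] x hG by (simp add: m_comm)
    also have "\<dots> = T w x" using triv h PiE_mem[OF Tw x] by blast
    finally show "(\<lambda>x\<in>carrier G. T w (x \<otimes>\<^bsub>G\<^esub> h)) x = T w x" using x by simp
  qed simp
  then show ?thesis using inj L.f_im[OF w] w by (meson inj_onD)
qed

context cyclic_quotient
begin

text \<open>When the kernel acts trivially its idempotent acts as the identity, so the product acts
  as f does, that is, as the identity of a nonzero space.\<close>

lemma mult_trivial_idempotent_ker_neq_0:
  assumes irr: "associated_irrep G f (module_vec TYPE(rat) d) \<theta>"
    and triv: "\<And>h v. h \<in> ker \<Longrightarrow> v \<in> carrier_vec d \<Longrightarrow> \<theta> h v = v"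
  shows "f \<otimes>\<^bsub>rat_group_algebra G\<^esub> trivial_idempotent ker \<noteq> \<zero>\<^bsub>rat_group_algebra G\<^esub>"
proof
  let ?V = "module_vec TYPE(rat) d"
  interpret W: vec_space "TYPE(rat)" d .
  assume fz: "f \<otimes>\<^bsub>rat_group_algebra G\<^esub> trivial_idempotent ker = \<zero>\<^bsub>rat_group_algebra G\<^esub>"
  have rep: "rat_rep G ?V \<theta>" and ne: "carrier ?V \<noteq> {\<zero>\<^bsub>?V\<^esub>}"
    and act: "\<And>v. v \<in> carrier ?V \<Longrightarrow> algebra_action G ?V \<theta> f v = v"
    using irr by (auto simp: associated_irrep_def irreducible_rat_rep_def)
  have closed: "\<theta> x v \<in> carrier_vec d" if "x \<in> carrier G" "v \<in> carrier_vec d" for x v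
  proof -
    interpret L: linear_map rat_field ?V ?V "\<theta> x" using that rep by (simp add: rat_rep_def)
    show ?thesis using L.f_im[of v] that by simp
  qed
  have "v = 0\<^sub>v d" if v: "v \<in> carrier_vec d" for v :: "rat vec"
  proof (rule eq_vecI)
    fix i assume "i < dim_vec (0\<^sub>v d)"
    then have i: "i < d" by simp
    define F where "F A = finsum ?V (\<lambda>x. f x \<cdot>\<^sub>v \<theta> x v) A" for A
    \<comment> \<open>Passing to a single coordinate turns vector sums into rational sums, to which
      \<open>sum_convolution\<close> applies with
      \<open>M x a = a * \<theta> x v $ i\<close>.\<close>
    have "dim_vec (F A) = d \<and> F A $ i = (\<Sum>x\<in>A. f x * \<theta> x v $ i)"
      if "finite A" "A \<subseteq> carrier G" for A
      using that
    proof induction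
      case (insert x A)
      then have "\<theta> x v \<in> carrier_vec d" "(\<lambda>x. f x \<cdot>\<^sub>v \<theta> x v) \<in> A \<rightarrow> carrier_vec d"
        using closed v by auto
      moreover from this have "F (insert x A) = f x \<cdot>\<^sub>v \<theta> x v + F A"
        unfolding F_def using insert by (subst W.finsum_insert) auto
      ultimately show ?case using insert i by simp
    qed (use i in \<open>simp add: F_def\<close>)
    from this[OF finite_carrier subset_refl] have "v $ i = (\<Sum>x\<in>carrier G. f x * \<theta> x v $ i)"
      using act[of v] v by (simp add: algebra_action_def F_def)
    also have "\<dots> = (\<Sum>y\<in>carrier G. \<Sum>z\<in>carrier G. f y * trivial_idempotent ker z * \<theta> (y \<otimes> z) v $ i)"
    proof (rule sum.cong[OF refl])
      fix y assume y: "y \<in> carrier G"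
      have "\<theta> (y \<otimes> z) v = \<theta> y v" if "z \<in> ker" for z
        using rep y that v triv ker_subset by (auto simp: rat_rep_def module_vec_simps)
      then have "(\<Sum>z\<in>carrier G. f y * trivial_idempotent ker z * \<theta> (y \<otimes> z) v $ i)
          = (\<Sum>z\<in>carrier G. if z \<in> ker then f y * \<theta> y v $ i / of_nat (card ker) else 0)"
        by (intro sum.cong) (auto simp: trivial_idempotent_def)
      also have "\<dots> = (\<Sum>z\<in>ker. f y * \<theta> y v $ i / of_nat (card ker))"
        using finite_carrier ker_subset by (simp add: sum.If_cases Int_absorb1)
      finally show "f y * \<theta> y v $ i = (\<Sum>z\<in>carrier G. f y * trivial_idempotent ker z * \<theta> (y \<otimes> z) v $ i)"
        using card_ker_pos by simp
    qed
    also have "\<dots> = (\<Sum>x\<in>carrier G. (f \<otimes>\<^bsub>rat_group_algebra G\<^esub> trivial_idempotent ker) x * \<theta> x v $ i)"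
      by (rule sum_convolution[symmetric]) (simp_all add: distrib_right)
    also have "\<dots> = 0" by (simp add: fz zero_rat_group_algebra)
    finally show "v $ i = 0\<^sub>v d $ i" using i by simp
  qed (use v in simp)
  moreover have "0\<^sub>v d \<in> carrier_vec d" by simp
  ultimately show False using ne unfolding module_vec_simps by blast
qed

lemma subgroup_ker: "subgroup ker G"
proof (rule subgroupI)
  show "ker \<subseteq> carrier G" by (rule ker_subset)
  show "ker \<noteq> {}" using idx_one by (auto simp: ker_def)
  fix a assume a: "a \<in> ker"
  then show "inv a \<in> ker" using idx_inv_mult_eq_0_iff[of \<one> a] by (simp add: ker_def idx_one)
  fix b assume "b \<in> ker"
  then show "a \<otimes> b \<in> ker" using a by (simp add: ker_def idx_mult)
qed

end

section \<open>The trivial idempotent and its two neighbours over a quotient of prime order\<close>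

lemma geometric_sum_poly_1: "geometric_sum_poly (Suc 0) = 1"
  by (simp add: geometric_sum_poly_def)

lemma linear_dvd_iff: "pCons (-1) 1 dvd q \<longleftrightarrow> poly q 1 = (0 :: rat)"
  using poly_eq_0_iff_dvd[of q 1] by simp

lemma poly_geometric_sum_poly: "poly (geometric_sum_poly n) 1 = of_nat n"
  by (simp add: geometric_sum_poly_def poly_sum poly_monom)

lemma irreducible_linear_factor: "irreducible ([:-1, 1:] :: rat poly)"
  by (simp add: linear_irreducible\<^sub>d flip: irreducible_connect_field)

text \<open>With one residue class the kernel is the whole group. This instance treats the trivial
  idempotent of an arbitrary finite abelian group, in particular the one of the lower level.\<close>

lemma (in comm_group) cyclic_quotient_factor_trivial:
  assumes "finite (carrier G)"
  shows "cyclic_quotient_factor G 1 (\<lambda>_. 0) [:-1, 1:] 1"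
  by unfold_locales
    (use assms irreducible_linear_factor geometric_sum_poly_mult[of 1] in \<open>auto simp: geometric_sum_poly_1\<close>)

lemma (in comm_group)
  assumes fin: "finite (carrier G)"
  shows primitive_trivial_idempotent:
      "primitive_central_idempotent (rat_group_algebra G) (trivial_idempotent (carrier G))"
    and ex_associated_irrep_trivial_idempotent:
      "\<exists>\<eta>. associated_irrep G (trivial_idempotent (carrier G)) (module_vec TYPE(rat) 1) \<eta>"
proof -
  interpret C: cyclic_quotient_factor G 1 "\<lambda>_. 0" "[:-1, 1:]" 1
    using fin by (rule cyclic_quotient_factor_trivial)
  have \<Psi>: "[:-1, 1:] dvd C.index_poly (trivial_idempotent (carrier G)) - 1"
    by (simp add: C.index_poly_trivial_idempotent_carrier geometric_sum_poly_1)
  show "primitive_central_idempotent (rat_group_algebra G) (trivial_idempotent (carrier G))"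
    using trivial_idempotent_closed[OF subset_refl] C.trivial_idempotent_carrier_mult_ker \<Psi> one_dvd
    by (rule C.primitive_central_idempotent_of_factor)
  show "\<exists>\<eta>. associated_irrep G (trivial_idempotent (carrier G)) (module_vec TYPE(rat) 1) \<eta>"
    using C.associated_irrep_quotient_rep[OF \<Psi>] by auto
qed

locale prime_cyclic_quotient = cyclic_quotient +
  assumes prime_n: "prime n"
begin

text \<open>The factorization of X^n - 1 is read in both directions: the first reading belongs to
  \<open>e_carrier\<close>, the second to \<open>e_diff\<close>.\<close>

sublocale linear: cyclic_quotient_factor G n idx "[:-1, 1:]" "geometric_sum_poly n"
  by unfold_locales (rule irreducible_linear_factor geometric_sum_poly_mult)+

sublocale cyclotomic: cyclic_quotient_factor G n idx "geometric_sum_poly n" "[:-1, 1:]"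
  by unfold_locales
    (use irreducible_geometric_sum_poly[OF prime_n] geometric_sum_poly_mult[of n] in \<open>simp_all only: mult.commute\<close>)

abbreviation e_carrier :: "'a \<Rightarrow> rat" where "e_carrier \<equiv> trivial_idempotent (carrier G)"
abbreviation e_ker :: "'a \<Rightarrow> rat" where "e_ker \<equiv> trivial_idempotent ker"
abbreviation e_diff :: "'a \<Rightarrow> rat" where "e_diff \<equiv> e_ker \<ominus>\<^bsub>rat_group_algebra G\<^esub> e_carrier"

lemma index_poly_e_diff: "index_poly e_diff = 1 - smult (1 / of_nat n) (geometric_sum_poly n)"
  using finite_carrier trivial_idempotent_closed[OF ker_subset] trivial_idempotent_closed[OF subset_refl[of "carrier G"]]
  by (simp add: minus_rat_group_algebra index_poly_diff index_poly_trivial_idempotent_ker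
      index_poly_trivial_idempotent_carrier)

text \<open>The geometric sum takes the value n at 1, which cancels the factor 1/n in
  \<open>index_poly e_carrier\<close>. The same value makes \<open>index_poly e_diff\<close> vanish
  at 1.\<close>

lemma linear_dvd_e_carrier: "[:-1, 1:] dvd index_poly e_carrier - 1"
  using n_pos by (simp add: linear_dvd_iff index_poly_trivial_idempotent_carrier poly_geometric_sum_poly)

lemma cyclotomic_dvd_e_diff: "geometric_sum_poly n dvd index_poly e_diff - 1"
  by (simp add: index_poly_e_diff dvd_smult)

lemma primitive_e_carrier: "primitive_central_idempotent (rat_group_algebra G) e_carrier"
  using finite_carrier by (rule primitive_trivial_idempotent)

lemma primitive_e_diff: "primitive_central_idempotent (rat_group_algebra G) e_diff"
proof (rule cyclotomic.primitive_central_idempotent_of_factor)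
  interpret A: cring "rat_group_algebra G"
    using finite_carrier by (rule cring_rat_group_algebra)
  note closed = trivial_idempotent_closed[OF ker_subset] trivial_idempotent_closed[OF subset_refl[of "carrier G"]]
  show "e_diff \<in> carrier (rat_group_algebra G)" using closed by simp
  show "e_diff \<otimes>\<^bsub>rat_group_algebra G\<^esub> e_ker = e_diff"
    using closed
    by (simp add: a_minus_def A.l_distr A.l_minus trivial_idempotent_ker_idem trivial_idempotent_carrier_mult_ker)
  show "geometric_sum_poly n dvd index_poly e_diff - 1" by (rule cyclotomic_dvd_e_diff)
  show "[:-1, 1:] dvd index_poly e_diff"
    using n_pos by (simp add: linear_dvd_iff index_poly_e_diff poly_geometric_sum_poly)
qed

lemma comm_group_ker: "comm_group (G\<lparr>carrier := ker\<rparr>)"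
  by (rule group.group_comm_groupI[OF subgroup.subgroup_is_group[OF subgroup_ker is_group]])
     (use ker_subset m_comm in auto)

text \<open>One one-dimensional \<open>\<eta>\<close> for the kernel serves both edges; averaging
  shows that it is trivial.\<close>

lemma pci_branches_e_ker:
  "pci_branches G ker (carrier G) e_ker e_carrier" "pci_branches G ker (carrier G) e_ker e_diff"
proof -
  interpret K: comm_group "G\<lparr>carrier := ker\<rparr>" by (rule comm_group_ker)
  obtain \<eta> where \<eta>: "associated_irrep (G\<lparr>carrier := ker\<rparr>) e_ker (module_vec TYPE(rat) 1) \<eta>"
    using K.ex_associated_irrep_trivial_idempotent finite_ker by auto
  have triv: "\<eta> h v = v" if "h \<in> ker" "v \<in> carrier_vec 1" for h v
    using K.trivial_action_of_trivial_idempotent[of "module_vec TYPE(rat) 1" \<eta> h v] \<eta> that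
    by (simp add: associated_irrep_def irreducible_rat_rep_def module_vec_simps)
  show "pci_branches G ker (carrier G) e_ker e_carrier"
    unfolding pci_branches_def
    using \<eta> linear.associated_irrep_quotient_rep[OF linear_dvd_e_carrier]
      linear.quotient_rep_occurs_in_induced[of \<eta>] triv by auto
  show "pci_branches G ker (carrier G) e_ker e_diff"
    unfolding pci_branches_def
    using \<eta> cyclotomic.associated_irrep_quotient_rep[OF cyclotomic_dvd_e_diff]
      cyclotomic.quotient_rep_occurs_in_induced[of \<eta>] triv by auto
qed

lemma pci_branches_e_ker_imp:
  assumes f: "primitive_central_idempotent (rat_group_algebra G) f"
    and br: "pci_branches G ker (carrier G) e_ker f"
  shows "f = e_carrier \<or> f = e_diff"
proof (rule ccontr)
  assume neq: "\<not> ?thesis"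
  interpret A: cring "rat_group_algebra G"
    using finite_carrier by (rule cring_rat_group_algebra)
  interpret K: comm_group "G\<lparr>carrier := ker\<rparr>" by (rule comm_group_ker)
  note closed = trivial_idempotent_closed[OF ker_subset] trivial_idempotent_closed[OF subset_refl[of "carrier G"]]
  have fc: "f \<in> carrier (rat_group_algebra G)"
    using f unfolding primitive_central_idempotent_def central_idempotent_def by blast
  obtain k \<eta> d \<theta> where
    \<eta>: "associated_irrep (G\<lparr>carrier := ker\<rparr>) e_ker (module_vec TYPE(rat) k) \<eta>"
    and \<theta>: "associated_irrep G f (module_vec TYPE(rat) d) \<theta>"
    and occ: "occurs_in G (module_vec TYPE(rat) d) \<theta>
      (induced_space G ker (module_vec TYPE(rat) k) \<eta>) (induced_action G)"
    using br unfolding pci_branches_def by auto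
  \<comment> \<open>Here \<open>\<eta>\<close> is any witness of the edge, of unspecified dimension
    k, so triviality has to come from \<open>e_ker\<close> acting as the identity.\<close>
  have triv_\<eta>: "\<eta> h v = v" if "h \<in> ker" "v \<in> carrier (module_vec TYPE(rat) k)" for h v
    using K.trivial_action_of_trivial_idempotent[of "module_vec TYPE(rat) k" \<eta> h v] \<eta> that
    by (simp add: associated_irrep_def irreducible_rat_rep_def)
  have "\<theta> h v = v" if "h \<in> ker" "v \<in> carrier_vec d" for h v
    using trivial_action_of_occurs_in_induced[OF occ comm_group_axioms _ ker_subset triv_\<eta> that(1), of v]
      \<theta> that(2) by (simp add: associated_irrep_def irreducible_rat_rep_def module_vec_simps)
  with \<theta> have nz: "f \<otimes>\<^bsub>rat_group_algebra G\<^esub> e_ker \<noteq> \<zero>\<^bsub>rat_group_algebra G\<^esub>"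
    by (rule mult_trivial_idempotent_ker_neq_0)
  have "f \<otimes>\<^bsub>rat_group_algebra G\<^esub> e_carrier = \<zero>\<^bsub>rat_group_algebra G\<^esub>"
    using A.primitive_central_idempotent_eqI[OF f primitive_e_carrier] neq by blast
  moreover have "f \<otimes>\<^bsub>rat_group_algebra G\<^esub> e_diff = \<zero>\<^bsub>rat_group_algebra G\<^esub>"
    using A.primitive_central_idempotent_eqI[OF f primitive_e_diff] neq by blast
  ultimately have "f \<otimes>\<^bsub>rat_group_algebra G\<^esub> e_ker = \<zero>\<^bsub>rat_group_algebra G\<^esub>"
    using closed fc by (simp add: a_minus_def A.r_distr A.r_minus A.m_closed)
  with nz show False ..
qed

end

section \<open>Extensions by an element of prime order\<close>

lemma (in comm_group) subgroup_comm_group: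
  assumes "subgroup H G"
  shows "comm_group (G\<lparr>carrier := H\<rparr>)"
  by (rule group.group_comm_groupI[OF subgroup.subgroup_is_group[OF assms is_group]])
     (use subgroup.subset[OF assms] m_comm in auto)

lemma (in group) subgroup_nat_pow_closed:
  assumes "subgroup H G" "h \<in> H"
  shows "h [^] (k :: nat) \<in> H"
  by (induction k) (use assms subgroup.one_closed subgroup.m_closed in \<open>simp_all\<close>)

context comm_group
begin

context
  fixes H :: "'a set" and u :: 'a and p :: nat
  assumes fin: "finite (carrier G)" and H: "subgroup H G" and u: "u \<in> carrier G"
    and p: "prime p" and u_notin: "u \<notin> H" and u_pow: "u [^] p \<in> H"
begin

text \<open>If p does not divide k, a Bezout relation k a = p b + 1 writes u as a product of
  elements of H.\<close>

lemma pow_mem_iff_dvd: "u [^] k \<in> H \<longleftrightarrow> p dvd k"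
proof
  assume "p dvd k"
  then obtain q where "k = p * q" ..
  then have "u [^] k = (u [^] p) [^] q" using u by (simp add: nat_pow_pow)
  then show "u [^] k \<in> H" using u_pow subgroup_nat_pow_closed[OF H] by simp
next
  assume k: "u [^] k \<in> H"
  show "p dvd k"
  proof (rule ccontr)
    assume "\<not> p dvd k"
    then have "gcd k p = 1" using p by (metis coprime_imp_gcd_eq_1 gcd.commute prime_imp_coprime)
    moreover have "k \<noteq> 0" using \<open>\<not> p dvd k\<close> by (cases "k = 0") auto
    ultimately obtain a b where ab: "k * a = p * b + 1" using bezout_nat[of k p] by auto
    have "(u [^] k) [^] a = (u [^] p) [^] b \<otimes> u"
    proof -
      have "(u [^] k) [^] a = u [^] (p * b + 1)" unfolding ab[symmetric] using u by (rule nat_pow_pow)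
      then show ?thesis using u by (simp add: nat_pow_pow)
    qed
    then have "u = inv ((u [^] p) [^] b) \<otimes> (u [^] k) [^] a"
      using u by (simp flip: m_assoc)
    also have "\<dots> \<in> H"
      using k u_pow subgroup_nat_pow_closed[OF H] subgroup.m_closed[OF H] subgroup.m_inv_closed[OF H]
      by blast
    finally show False using u_notin by blast
  qed
qed

text \<open>This makes the exponent of u modulo p a well-defined function on the generated group.
  Assuming a \<le> b keeps the exponent of the quotient a natural number.\<close>

lemma mult_pow_eq_imp_cong:
  assumes h: "h \<in> H" "h' \<in> H" and eq: "h \<otimes> u [^] a = h' \<otimes> u [^] b"
  shows "a mod p = b mod p"
proof -
  have "b mod p = a mod p"
    if "a \<le> b" "h \<in> H" "h' \<in> H" "h \<otimes> u [^] a = h' \<otimes> u [^] b" for h h' a b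
  proof -
    have hG: "h \<in> carrier G" "h' \<in> carrier G" using that subgroup.mem_carrier[OF H] by auto
    have "u [^] b = u [^] (b - a) \<otimes> u [^] a" using u that(1) by (simp add: nat_pow_mult)
    then have "h \<otimes> u [^] a = (h' \<otimes> u [^] (b - a)) \<otimes> u [^] a"
      using that(4) u hG by (simp add: m_assoc)
    then have "h = h' \<otimes> u [^] (b - a)" using u hG by simp
    then have "u [^] (b - a) = inv h' \<otimes> h" using u hG by (simp flip: m_assoc)
    then have "p dvd b - a"
      using that subgroup.m_closed[OF H] subgroup.m_inv_closed[OF H] pow_mem_iff_dvd by metis
    then show ?thesis using that(1) by (simp add: mod_eq_dvd_iff_nat)
  qed
  then show ?thesis using h eq by (metis nat_le_linear)
qed

lemma generate_insert_eq: "generate G (insert u H) = {h \<otimes> u [^] k | h k. h \<in> H \<and> k \<in> (UNIV :: nat set)}"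
  (is "_ = ?K")
proof
  note HG = subgroup.mem_carrier[OF H]
  have "subgroup ?K G"
  proof (rule subgroupI)
    show "?K \<subseteq> carrier G" using u HG by auto
    show "?K \<noteq> {}" using subgroup.one_closed[OF H] by blast
    fix a assume "a \<in> ?K"
    then obtain h and k :: nat where a: "a = h \<otimes> u [^] k" "h \<in> H" by blast
    \<comment> \<open>The inverse of u^k is rewritten with a natural exponent as u^((p - 1) k) times
      the inverse of u^(p k), and the latter lies in H.\<close>
    have "inv a = (inv h \<otimes> inv ((u [^] p) [^] k)) \<otimes> u [^] ((p - 1) * k)"
    proof (rule inv_equality)
      let ?s = "u [^] ((p - 1) * k)" and ?w = "(u [^] p) [^] k"
      have "p * k = (p - 1) * k + k" using prime_gt_0_nat[OF p] by (cases p) auto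
      then have w: "?w = ?s \<otimes> u [^] k" using u by (simp add: nat_pow_pow nat_pow_mult)
      have "((inv h \<otimes> inv ?w) \<otimes> ?s) \<otimes> a = (inv h \<otimes> h) \<otimes> (inv ?w \<otimes> (?s \<otimes> u [^] k))"
      proof -
        have "((a \<otimes> b) \<otimes> c) \<otimes> (d \<otimes> e) = (a \<otimes> d) \<otimes> (b \<otimes> (c \<otimes> e))"
          if "a \<in> carrier G" "b \<in> carrier G" "c \<in> carrier G" "d \<in> carrier G" "e \<in> carrier G"
          for a b c d e using that by (simp add: m_ac)
        then show ?thesis unfolding a(1) using a(2) u HG by simp
      qed
      also have "\<dots> = \<one>" unfolding w[symmetric] using a u HG by simp
      finally show "((inv h \<otimes> inv ?w) \<otimes> ?s) \<otimes> a = \<one>" .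
    qed (use a u HG in auto)
    moreover have "inv h \<otimes> inv ((u [^] p) [^] k) \<in> H"
      using a u_pow subgroup_nat_pow_closed[OF H] subgroup.m_closed[OF H] subgroup.m_inv_closed[OF H]
      by blast
    ultimately show "inv a \<in> ?K" by blast
    fix b assume "b \<in> ?K"
    then obtain h' and k' :: nat where b: "b = h' \<otimes> u [^] k'" "h' \<in> H" by blast
    have "a \<otimes> b = (h \<otimes> h') \<otimes> u [^] (k + k')"
      using a b u HG by (simp add: m_ac flip: nat_pow_mult)
    then show "a \<otimes> b \<in> ?K" using a b subgroup.m_closed[OF H] by blast
  qed
  moreover have "insert u H \<subseteq> ?K"
  proof -
    have "u = \<one> \<otimes> u [^] (1 :: nat)" using u by simp
    moreover have "h = h \<otimes> u [^] (0 :: nat)" if "h \<in> H" for h using that HG by simp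
    ultimately show ?thesis using subgroup.one_closed[OF H] by blast
  qed
  ultimately show "generate G (insert u H) \<subseteq> ?K" by (rule generate_subgroup_incl[rotated])
  have gen: "subgroup (generate G (insert u H)) G" using u HG by (intro generate_is_subgroup) auto
  then have u_pow_mem: "u [^] k \<in> generate G (insert u H)" for k :: nat
    by (intro subgroup_nat_pow_closed[OF gen] generate.incl) simp
  then show "?K \<subseteq> generate G (insert u H)"
  proof (intro subsetI)
    fix y assume "y \<in> ?K"
    then obtain h and k :: nat where "y = h \<otimes> u [^] k" "h \<in> H" by blast
    then show "y \<in> generate G (insert u H)"
      using u_pow_mem[of k] by (auto intro: generate.eng generate.incl)
  qed
qed

text \<open>\<open>idx\<close> sends h u^k to k modulo p. The exponent is picked by choice and
  reduced afterwards, so the result is independent of the pick. The values at powers of u identify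
  these powers as coset representatives.\<close>

lemma prime_cyclic_quotient_generate_insert:
  obtains idx where "prime_cyclic_quotient (G\<lparr>carrier := generate G (insert u H)\<rparr>) p idx"
    and "cyclic_quotient.ker (G\<lparr>carrier := generate G (insert u H)\<rparr>) idx = H"
    and "\<And>k :: nat. k < p \<Longrightarrow> idx (u [^] k) = k"
proof -
  let ?K = "generate G (insert u H)"
  note HG = subgroup.mem_carrier[OF H]
  define idx where "idx y = (SOME k. \<exists>h\<in>H. y = h \<otimes> u [^] k) mod p" for y
  have idx: "idx (h \<otimes> u [^] k) = k mod p" if "h \<in> H" for h and k :: nat
  proof -
    have "\<exists>h'\<in>H. h \<otimes> u [^] k = h' \<otimes> u [^] (SOME k'::nat. \<exists>h'\<in>H. h \<otimes> u [^] k = h' \<otimes> u [^] k')"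
      by (rule someI[of "\<lambda>k'. \<exists>h'\<in>H. h \<otimes> u [^] k = h' \<otimes> u [^] k'" k]) (use that in blast)
    then obtain h' where "h' \<in> H" "h \<otimes> u [^] k = h' \<otimes> u [^] (SOME k'::nat. \<exists>h'\<in>H. h \<otimes> u [^] k = h' \<otimes> u [^] k')"
      by (rule bexE)
    from mult_pow_eq_imp_cong[OF that this] show ?thesis unfolding idx_def by (rule sym)
  qed
  have p0: "p > 0" using p by (rule prime_gt_0_nat)
  have sub: "subgroup ?K G" using u HG by (intro generate_is_subgroup) auto
  interpret K: comm_group "G\<lparr>carrier := ?K\<rparr>" using sub by (rule subgroup_comm_group)
  have KG: "?K \<subseteq> carrier G" using sub by (rule subgroup.subset)
  have elim: "\<exists>h\<in>H. \<exists>k::nat. y = h \<otimes> u [^] k" if "y \<in> ?K" for y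
    using that unfolding generate_insert_eq by blast
  have "cyclic_quotient (G\<lparr>carrier := ?K\<rparr>) p idx"
  proof unfold_locales
    show "finite (carrier (G\<lparr>carrier := ?K\<rparr>))" using KG fin finite_subset by auto
    show "idx y < p" for y unfolding idx_def using p0 by simp
    show "idx (y \<otimes>\<^bsub>G\<lparr>carrier := ?K\<rparr>\<^esub> z) = (idx y + idx z) mod p"
      if yz: "y \<in> carrier (G\<lparr>carrier := ?K\<rparr>)" "z \<in> carrier (G\<lparr>carrier := ?K\<rparr>)" for y z
    proof -
      from yz have "y \<in> ?K" "z \<in> ?K" by simp_all
      obtain h and k :: nat where y: "h \<in> H" "y = h \<otimes> u [^] k" using elim[OF \<open>y \<in> ?K\<close>] by blast
      obtain h' and k' :: nat where z: "h' \<in> H" "z = h' \<otimes> u [^] k'" using elim[OF \<open>z \<in> ?K\<close>] by blast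
      have "y \<otimes> z = (h \<otimes> h') \<otimes> u [^] (k + k')"
        using y z u HG by (simp add: m_ac flip: nat_pow_mult)
      then show ?thesis
        using y z subgroup.m_closed[OF H] by (simp add: idx mod_simps)
    qed
    show "\<exists>y\<in>carrier (G\<lparr>carrier := ?K\<rparr>). idx y = i" if "i < p" for i
    proof
      show "idx (\<one> \<otimes> u [^] i) = i" using that subgroup.one_closed[OF H] by (simp add: idx)
      show "\<one> \<otimes> u [^] i \<in> carrier (G\<lparr>carrier := ?K\<rparr>)"
        using subgroup.one_closed[OF H] unfolding generate_insert_eq by auto
    qed
  qed
  then interpret C: cyclic_quotient "G\<lparr>carrier := ?K\<rparr>" p idx .
  have "prime_cyclic_quotient (G\<lparr>carrier := ?K\<rparr>) p idx" using p by unfold_locales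
  moreover have "C.ker = H"
  proof (intro equalityI subsetI)
    fix y assume "y \<in> C.ker"
    then have "y \<in> ?K" "idx y = 0" by (auto simp: C.ker_def)
    with elim obtain h and k :: nat where y: "h \<in> H" "y = h \<otimes> u [^] k" by blast
    with \<open>idx y = 0\<close> have "u [^] k \<in> H" by (simp add: idx pow_mem_iff_dvd dvd_eq_mod_eq_0)
    then show "y \<in> H" using y subgroup.m_closed[OF H] by blast
  next
    fix h assume "h \<in> H"
    then have "idx (h \<otimes> u [^] (0 :: nat)) = 0" "h \<in> ?K"
      by (simp_all only: idx) (auto intro: generate.incl)
    then show "h \<in> C.ker" using HG \<open>h \<in> H\<close> by (simp add: C.ker_def)
  qed
  moreover have "idx (u [^] k) = k" if "k < p" for k :: nat
    using idx[OF subgroup.one_closed[OF H], of k] u that by simp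
  ultimately show thesis by (rule that)
qed

end

end

section \<open>The series of a long presentation\<close>

text \<open>P is required between distinct blocks in either direction, so increasing and reversed
  enumerations of the blocks are treated alike.\<close>

lemma sorted_wrt_concat_map:
  assumes "\<And>y. y \<in> set ys \<Longrightarrow> sorted_wrt P (f y)"
    and "\<And>y y' a b. y \<noteq> y' \<Longrightarrow> a \<in> set (f y) \<Longrightarrow> b \<in> set (f y') \<Longrightarrow> P a b"
    and "distinct ys"
  shows "sorted_wrt P (concat (map f ys))"
  using assms(1,3)
proof (induction ys)
  case (Cons y ys)
  then have "P a b" if "a \<in> set (f y)" "b \<in> set (concat (map f ys))" for a b
  proof -
    obtain y' where "y' \<in> set ys" "b \<in> set (f y')" using \<open>b \<in> _\<close> by auto
    then show ?thesis using that(1) Cons.prems(2) by (intro assms(2)[of y y']) auto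
  qed
  then show ?case using Cons by (auto simp: sorted_wrt_append)
qed simp

text \<open>The argument runs on index triples rather than group elements, since a value of x might
  a priori occur under several indices.\<close>

lemma long_generators_predecessors:
  assumes "l < length (long_generators m r c x)"
  obtains i j a where "i \<in> {1..m}" "j \<in> {1..c i}" "a \<in> {1..r i}"
    and "long_generators m r c x ! l = x i j a"
    and "\<And>y. y \<in> set (take l (long_generators m r c x)) \<Longrightarrow>
      \<exists>i'\<in>{1..m}. \<exists>j'\<in>{1..c i'}. \<exists>a'\<in>{1..r i'}. y = x i' j' a' \<and> ((i', j') = (i, j) \<longrightarrow> a' < a)"
    and "1 < a \<Longrightarrow> x i j (a - 1) \<in> set (take l (long_generators m r c x))"
proof -
  define ts where "ts = concat (map (\<lambda>i. concat (map (\<lambda>j. map (\<lambda>a. (i, j, a)) [1..<Suc (r i)])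
    (rev [1..<Suc (c i)]))) [1..<Suc m])"
  define X where "X = (\<lambda>(i, j, a). x i j a)"
  have xs: "long_generators m r c x = map X ts"
    by (simp add: long_generators_def ts_def X_def map_concat comp_def)
  \<comment> \<open>P relates all triples from different factors and orders those of one factor by
    a.\<close>
  define P where "P = (\<lambda>(i :: nat, j :: nat, a :: nat) (i', j', a'). (i, j) = (i', j') \<longrightarrow> a < a')"
  have sorted: "sorted_wrt P ts"
    unfolding ts_def
    by (intro sorted_wrt_concat_map) (auto simp: P_def sorted_wrt_map simp del: upt_Suc)
  have set_ts: "set ts = {(i, j, a). i \<in> {1..m} \<and> j \<in> {1..c i} \<and> a \<in> {1..r i}}"
    by (force simp: ts_def simp del: upt_Suc)
  have l: "l < length ts" using assms by (simp add: xs)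
  obtain i j a where t: "ts ! l = (i, j, a)" by (cases "ts ! l")
  show thesis
  proof (rule that)
    have "(i, j, a) \<in> set ts" using l t nth_mem by metis
    then show "i \<in> {1..m}" "j \<in> {1..c i}" "a \<in> {1..r i}" by (simp_all add: set_ts)
    show "long_generators m r c x ! l = x i j a" using l t by (simp add: xs X_def)
    show "\<exists>i'\<in>{1..m}. \<exists>j'\<in>{1..c i'}. \<exists>a'\<in>{1..r i'}. y = x i' j' a' \<and> ((i', j') = (i, j) \<longrightarrow> a' < a)"
      if y: "y \<in> set (take l (long_generators m r c x))" for y
    proof -
      obtain q where q: "q < l" "y = X (ts ! q)"
        using y l by (auto simp: xs in_set_conv_nth)
      obtain i' j' a' where t': "ts ! q = (i', j', a')" by (cases "ts ! q")
      have "(i', j', a') \<in> set ts" using q l t' nth_mem[of q ts] by simp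
      moreover have "P (ts ! q) (ts ! l)" using sorted q l by (simp add: sorted_wrt_iff_nth_less)
      ultimately show ?thesis using q t t' by (force simp: set_ts P_def X_def)
    qed
    show "x i j (a - 1) \<in> set (take l (long_generators m r c x))" if "1 < a"
    proof -
      have "(i, j, a - 1) \<in> set ts" using \<open>(i, j, a) \<in> set ts\<close> that by (auto simp: set_ts)
      then obtain q where q: "q < length ts" "ts ! q = (i, j, a - 1)" by (auto simp: in_set_conv_nth)
      have "\<not> l < q"
      proof
        assume "l < q"
        then have "P (ts ! l) (ts ! q)" using sorted q(1) by (simp add: sorted_wrt_iff_nth_less)
        then show False using t q by (simp add: P_def)
      qed
      moreover have "q \<noteq> l" using t q that by auto
      ultimately have "q < l" by simp
      then have "take l (long_generators m r c x) ! q = x i j (a - 1)" "q < length (take l (long_generators m r c x))"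
        using l q by (simp_all add: xs X_def)
      then show ?thesis by (metis nth_mem)
    qed
  qed
qed

section \<open>Powers and orders of the long generators, and the steps of the series\<close>

context comm_group
begin

context
  fixes p m :: nat and r c :: "nat \<Rightarrow> nat" and x :: "nat \<Rightarrow> nat \<Rightarrow> nat \<Rightarrow> 'a"
  assumes fin: "finite (carrier G)" and p: "prime p" and lp: "long_presentation p G m r c x"
begin

context
  fixes i j
  assumes i: "i \<in> {1..m}" and j: "j \<in> {1..c i}"
begin

lemma long_generator_closed: "a \<in> {1..r i} \<Longrightarrow> x i j a \<in> carrier G"
  using lp i j by (auto simp: long_presentation_def)

lemma long_generator_pow: "1 < a \<Longrightarrow> a \<le> r i \<Longrightarrow> x i j a [^] p = x i j (a - 1)"
  using lp i j by (auto simp: long_presentation_def)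

lemma long_generator_one_pow: "x i j 1 [^] p = \<one>"
  using lp i j by (auto simp: long_presentation_def)

lemma long_generator_rank_pos: "1 \<le> r i"
  using lp i by (auto simp: long_presentation_def)

lemma long_generator_pow_pow:
  "k < a \<Longrightarrow> a \<le> r i \<Longrightarrow> x i j a [^] (p ^ k) = x i j (a - k)"
proof (induction k)
  case (Suc k)
  have "x i j a [^] (p ^ Suc k) = (x i j a [^] (p ^ k)) [^] p"
    using Suc.prems long_generator_closed[of a] by (simp add: nat_pow_pow mult.commute)
  also have "\<dots> = x i j (a - k) [^] p" using Suc by simp
  also have "\<dots> = x i j (a - k - 1)" using Suc.prems by (intro long_generator_pow) auto
  finally show ?case by simp
qed (use long_generator_closed in simp)

lemma long_generator_in_factor: "a \<in> {1..r i} \<Longrightarrow> x i j a \<in> generate G {x i j (r i)}"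
proof -
  assume a: "a \<in> {1..r i}"
  then have "x i j a = x i j (r i) [^] (p ^ (r i - a))"
    by (subst long_generator_pow_pow) auto
  moreover have "subgroup (generate G {x i j (r i)}) G"
    using long_generator_closed[of "r i"] long_generator_rank_pos by (intro generate_is_subgroup) auto
  ultimately show ?thesis using subgroup_nat_pow_closed generate.incl by (metis singletonI)
qed

text \<open>It is the p^(r - 1)-th power of a generator whose order is exactly p^r.\<close>

lemma long_generator_one_neq_one: "x i j 1 \<noteq> \<one>"
proof
  assume 1: "x i j 1 = \<one>"
  let ?y = "x i j (r i)"
  have y: "?y \<in> carrier G" using long_generator_closed long_generator_rank_pos by auto
  have "?y [^] (p ^ (r i - 1)) = \<one>"
    using long_generator_pow_pow[of "r i - 1" "r i"] long_generator_rank_pos 1 by simp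
  then have "ord ?y dvd p ^ (r i - 1)" using y by (simp add: pow_eq_id)
  moreover have "ord ?y = p ^ r i"
    using generate_pow_card[OF y] lp i j by (auto simp: long_presentation_def)
  ultimately have "p ^ r i \<le> p ^ (r i - 1)"
    using p by (metis dvd_imp_le prime_gt_0_nat zero_less_power)
  then show False
    using power_le_imp_le_exp[OF prime_gt_1_nat[OF p]] long_generator_rank_pos by fastforce
qed

lemma long_generator_pow_eq_one: "a \<in> {1..r i} \<Longrightarrow> a \<le> k \<Longrightarrow> x i j a [^] (p ^ k) = \<one>"
proof -
  assume a: "a \<in> {1..r i}" and k: "a \<le> k"
  have "p ^ k = p ^ (a - 1) * (p * p ^ (k - a))"
  proof -
    have "k = (a - 1) + Suc (k - a)" using a k by auto
    then have "p ^ k = p ^ ((a - 1) + Suc (k - a))" by (rule arg_cong)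
    then show ?thesis by (simp add: power_add)
  qed
  then have "x i j a [^] (p ^ k) = ((x i j a [^] (p ^ (a - 1))) [^] p) [^] (p ^ (k - a))"
    using long_generator_closed[OF a] by (simp add: nat_pow_pow mult.assoc)
  also have "x i j a [^] (p ^ (a - 1)) = x i j 1" using a by (subst long_generator_pow_pow) auto
  finally show ?thesis by (simp add: long_generator_one_pow[simplified])
qed

end

text \<open>The elements whose \<open>(i, j)\<close>-component is killed by $p^{a-1}$ form a subgroup
  containing the generators that precede \<open>x i j a\<close>, but not \<open>x i j a\<close> itself.\<close>

lemma long_generator_notin_generate:
  assumes i: "i \<in> {1..m}" and j: "j \<in> {1..c i}" and a: "a \<in> {1..r i}"
    and Y: "\<And>y. y \<in> Y \<Longrightarrow>
      \<exists>i'\<in>{1..m}. \<exists>j'\<in>{1..c i'}. \<exists>a'\<in>{1..r i'}. y = x i' j' a' \<and> ((i', j') = (i, j) \<longrightarrow> a' < a)"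
  shows "x i j a \<notin> generate G Y"
proof
  assume mem: "x i j a \<in> generate G Y"
  define I where "I = (SIGMA i:{1..m}. {1..c i})"
  define F where "F = (\<lambda>(i, j). G\<lparr>carrier := generate G {x i j (r i)}\<rparr>)"
  define P where "P = product_group I F"
  define \<Phi> where "\<Phi> = (\<lambda>f. finprod G f I)"
  have iso: "\<Phi> \<in> iso P G"
    using lp unfolding long_presentation_def Let_def \<Phi>_def P_def F_def I_def by blast
  have finI: "finite I" unfolding I_def by auto
  have ij: "(i, j) \<in> I" using i j by (simp add: I_def)
  have subF: "subgroup (generate G {x i' j' (r i')}) G" if "(i', j') \<in> I" for i' j'
    using that long_generator_closed[of i' j' "r i'"] long_generator_rank_pos[of i' j']
    by (intro generate_is_subgroup) (auto simp: I_def)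
  have grpF: "group (F t)" if "t \<in> I" for t
    using that subF by (cases t) (auto simp: F_def intro!: subgroup.subgroup_is_group is_group)
  interpret P: group P unfolding P_def by (rule product_group) (rule grpF)
  interpret \<Phi>: group_hom P G \<Phi>
    by unfold_locales (use iso in \<open>simp add: iso_def\<close>)
  have carrier_F: "carrier (F t) \<subseteq> carrier G" if "t \<in> I" for t
    using that subgroup.subset[OF subF] by (cases t) (auto simp: F_def)
  have carrier_P: "carrier P = (\<Pi>\<^sub>E t\<in>I. carrier (F t))" by (simp add: P_def)
  have ops_F: "monoid.mult (F t) = monoid.mult G" "monoid.one (F t) = \<one>" for t by (simp_all add: F_def split: prod.splits)
  \<comment> \<open>The exponent that separates: it kills every \<open>x i j a'\<close> with a' < a,
    but sends \<open>x i j a\<close> to \<open>x i j 1\<close>, which is not the identity.\<close>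
  let ?q = "p ^ (a - 1)"
  define B where "B = {f \<in> carrier P. f (i, j) [^] ?q = \<one>}"
  have comp: "f (i, j) \<in> carrier G" if "f \<in> carrier P" for f
    using that carrier_F[OF ij] ij by (auto simp: carrier_P dest: PiE_mem)
  have mult_P: "(f \<otimes>\<^bsub>P\<^esub> g) (i, j) = f (i, j) \<otimes> g (i, j)" for f g
    using ij by (simp add: P_def ops_F)
  have one_P: "\<one>\<^bsub>P\<^esub> (i, j) = \<one>"
    using ij by (simp add: P_def ops_F)
  have "subgroup B P"
  proof (rule P.subgroupI)
    show "B \<subseteq> carrier P" by (auto simp: B_def)
    show "B \<noteq> {}" using one_P P.one_closed by (force simp: B_def)
    fix f assume f: "f \<in> B"
    then have fP: "f \<in> carrier P" by (simp add: B_def)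
    have "(inv\<^bsub>P\<^esub> f) (i, j) \<otimes> f (i, j) = \<one>"
      using P.l_inv[OF fP] mult_P one_P by metis
    then have "(inv\<^bsub>P\<^esub> f) (i, j) = inv (f (i, j))"
      using comp fP P.inv_closed[OF fP] by (metis inv_equality)
    then show "inv\<^bsub>P\<^esub> f \<in> B"
      using f comp[OF fP] by (simp add: B_def nat_pow_inv)
    fix g assume g: "g \<in> B"
    then show "f \<otimes>\<^bsub>P\<^esub> g \<in> B"
      using f comp by (simp add: B_def mult_P nat_pow_distrib)
  qed
  then have sub: "subgroup (\<Phi> ` B) G" by (rule \<Phi>.subgroup_img_is_subgroup)
  \<comment> \<open>The tuple with y in position t and the identity elsewhere: the preimage of y
    under the product isomorphism.\<close>
  define \<delta> where "\<delta> t y = (\<lambda>t'\<in>I. if t' = t then y else \<one>)" for t :: "nat \<times> nat" and y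
  have \<delta>_closed: "\<delta> (i', j') (x i' j' a') \<in> carrier P"
    if "(i', j') \<in> I" "a' \<in> {1..r i'}" for i' j' a'
    unfolding carrier_P
  proof (rule PiE_I)
    fix t assume t: "t \<in> I"
    have "\<one> \<in> carrier (F t)" using group.is_monoid[OF grpF[OF t]] monoid.one_closed ops_F by metis
    moreover have "x i' j' a' \<in> carrier (F (i', j'))"
      using that long_generator_in_factor[of i' j' a'] by (auto simp: F_def I_def)
    ultimately show "\<delta> (i', j') (x i' j' a') t \<in> carrier (F t)" using t by (simp add: \<delta>_def)
  qed (simp add: \<delta>_def)
  have \<Phi>_\<delta>: "\<Phi> (\<delta> t y) = y" if "t \<in> I" "y \<in> carrier G" for t y
  proof -
    have "\<Phi> (\<delta> t y) = finprod G (\<lambda>t'. if t' = t then y else \<one>) I"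
      unfolding \<Phi>_def using that by (intro finprod_cong') (auto simp: \<delta>_def)
    also have "\<dots> = y" using that finI finprod_singleton_swap[of t I "\<lambda>_. y"] by simp
    finally show ?thesis .
  qed
  have "Y \<subseteq> \<Phi> ` B"
  proof
    fix y assume "y \<in> Y"
    then obtain i' j' a' where t: "i' \<in> {1..m}" "j' \<in> {1..c i'}" "a' \<in> {1..r i'}"
      and y: "y = x i' j' a'" and less: "(i', j') = (i, j) \<longrightarrow> a' < a"
      using Y by blast
    then have tI: "(i', j') \<in> I" and yG: "y \<in> carrier G"
      using long_generator_closed by (auto simp: I_def)
    have "\<delta> (i', j') y (i, j) [^] ?q = \<one>"
      using ij less t y long_generator_pow_eq_one[OF i j, of a' "a - 1"] by (auto simp: \<delta>_def)
    then have "\<delta> (i', j') y \<in> B" using \<delta>_closed[OF tI t(3)] y by (simp add: B_def)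
    then show "y \<in> \<Phi> ` B" using \<Phi>_\<delta>[OF tI yG] by (metis imageI)
  qed
  then have "x i j a \<in> \<Phi> ` B" using generate_subgroup_incl[OF _ sub] mem by blast
  then obtain f where f: "f \<in> B" "x i j a = \<Phi> f" by blast
  \<comment> \<open>Injectivity makes the preimage unique, so membership in the image of B forces
    the component \<open>x i j a\<close> itself to be killed.\<close>
  have "\<Phi> f = \<Phi> (\<delta> (i, j) (x i j a))"
    using f \<Phi>_\<delta>[OF ij long_generator_closed[OF i j a]] by simp
  moreover have "inj_on \<Phi> (carrier P)" using iso by (simp add: iso_def bij_betw_def)
  ultimately have "f = \<delta> (i, j) (x i j a)"
    using f \<delta>_closed[OF ij a] by (simp add: inj_on_def B_def)
  then have "f (i, j) = x i j a" using ij by (simp only: \<delta>_def restrict_apply') simp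
  moreover have "f (i, j) [^] ?q = \<one>" using f by (simp add: B_def)
  ultimately have "x i j a [^] ?q = \<one>" by simp
  moreover have "x i j a [^] ?q = x i j 1" using long_generator_pow_pow[OF i j, of "a - 1" a] a by simp
  ultimately show False using long_generator_one_neq_one[OF i j] by simp
qed

lemma generator_series_step:
  assumes l: "l < length (long_generators m r c x)"
  defines "xs \<equiv> long_generators m r c x"
  shows "subgroup (generator_series G xs l) G"
    and "xs ! l \<in> carrier G"
    and "xs ! l \<notin> generator_series G xs l"
    and "xs ! l [^] p \<in> generator_series G xs l"
    and "generator_series G xs (Suc l) = generate G (insert (xs ! l) (generator_series G xs l))"
proof -
  obtain i j a where ija: "i \<in> {1..m}" "j \<in> {1..c i}" "a \<in> {1..r i}"
    and u: "xs ! l = x i j a"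
    and pre: "\<And>y. y \<in> set (take l xs) \<Longrightarrow>
      \<exists>i'\<in>{1..m}. \<exists>j'\<in>{1..c i'}. \<exists>a'\<in>{1..r i'}. y = x i' j' a' \<and> ((i', j') = (i, j) \<longrightarrow> a' < a)"
    and prev: "1 < a \<Longrightarrow> x i j (a - 1) \<in> set (take l xs)"
    using long_generators_predecessors[OF l] unfolding xs_def by metis
  have "set (take l xs) \<subseteq> carrier G" using pre long_generator_closed by blast
  then show sub: "subgroup (generator_series G xs l) G"
    unfolding generator_series_def by (rule generate_is_subgroup)
  show uG: "xs ! l \<in> carrier G" unfolding u using ija by (rule long_generator_closed)
  show "xs ! l \<notin> generator_series G xs l"
    unfolding u generator_series_def using ija pre by (rule long_generator_notin_generate)
  show "xs ! l [^] p \<in> generator_series G xs l"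
  proof (cases "a = 1")
    case True
    then show ?thesis
      using long_generator_one_pow[OF ija(1,2)] subgroup.one_closed[OF sub] by (simp add: u)
  next
    case False
    then have "xs ! l [^] p = x i j (a - 1)" "1 < a" using long_generator_pow[of i j a] ija by (auto simp: u)
    then show ?thesis using prev unfolding generator_series_def by (auto intro: generate.incl)
  qed
  have take: "set (take (Suc l) xs) = insert (xs ! l) (set (take l xs))"
    using l by (simp add: take_Suc_conv_app_nth xs_def)
  let ?S = "set (take l xs)"
  show "generator_series G xs (Suc l) = generate G (insert (xs ! l) (generator_series G xs l))"
  proof (rule antisym)
    show "generator_series G xs (Suc l) \<subseteq> generate G (insert (xs ! l) (generator_series G xs l))"
      unfolding generator_series_def take by (rule mono_generate) (auto intro: generate.incl)
    have "subgroup (generate G (insert (xs ! l) ?S)) G"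
      using uG \<open>?S \<subseteq> carrier G\<close> by (intro generate_is_subgroup) auto
    moreover have "insert (xs ! l) (generate G ?S) \<subseteq> generate G (insert (xs ! l) ?S)"
      using mono_generate[of ?S "insert (xs ! l) ?S"] by (auto intro: generate.incl)
    ultimately show "generate G (insert (xs ! l) (generator_series G xs l)) \<subseteq> generator_series G xs (Suc l)"
      unfolding generator_series_def take by (rule generate_subgroup_incl[rotated])
  qed
qed

end

end

section \<open>Neighbours of the trivial idempotent\<close>

lemma e_elem_closed:
  assumes "group G" "u \<in> carrier G"
  shows "e_elem p G u \<in> carrier (rat_group_algebra G)"
proof -
  interpret group G by fact
  show ?thesis
    using assms(2) by (auto simp: e_elem_def carrier_rat_group_algebra intro!: sum.neutral)
qed

text \<open>Summation over k rather than over the set of powers counts repeated powers with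
  multiplicity. Commutativity moves the sum of point masses to the left, where the convolution
  collapses.\<close>

lemma (in comm_group) mult_e_elem:
  assumes fin: "finite (carrier G)" and u: "u \<in> carrier G" and x: "x \<in> carrier G"
  shows "(f \<otimes>\<^bsub>rat_group_algebra G\<^esub> e_elem p G u) x = (\<Sum>k<p. f (inv (u [^] k) \<otimes> x)) / of_nat p"
proof -
  have "(f \<otimes>\<^bsub>rat_group_algebra G\<^esub> e_elem p G u) x = (e_elem p G u \<otimes>\<^bsub>rat_group_algebra G\<^esub> f) x"
    by (simp only: rat_group_algebra_mult_commute)
  also have "\<dots> = (\<Sum>y\<in>carrier G. (\<Sum>k<p. if y = u [^] k then f (inv y \<otimes> x) else 0) / of_nat p)"
    using x by (auto simp: mult_rat_group_algebra e_elem_def sum_distrib_right intro!: sum.cong)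
  also have "\<dots> = (\<Sum>k<p. \<Sum>y\<in>carrier G. if y = u [^] k then f (inv y \<otimes> x) else 0) / of_nat p"
    by (subst sum.swap) (simp add: sum_divide_distrib)
  also have "\<dots> = (\<Sum>k<p. f (inv (u [^] k) \<otimes> x)) / of_nat p"
    using fin u by simp
  finally show ?thesis .
qed

text \<open>An edge is an unordered pair, but the level tags exclude the swapped reading, which
  would need l = Suc (Suc l).\<close>

lemma pci_edges_iff:
  "{(l, e), (Suc l, f)} \<in> pci_edges G S N \<longleftrightarrow>
    (l, e) \<in> pci_vertices G S N \<and> (Suc l, f) \<in> pci_vertices G S N \<and>
    pci_branches G (S l) (S (Suc l)) e f"
  by (auto simp: pci_edges_def doubleton_eq_iff)

text \<open>The translates of H by u^k with k < p partition K, so averaging the uniform weight 1/|H|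
  over them gives 1/(p |H|) = 1/|K| on K and 0 elsewhere.\<close>

lemma (in comm_group) trivial_idempotent_mult_e_elem:
  fixes p :: nat
  assumes fin: "finite (carrier G)" and H: "subgroup H G" and u: "u \<in> carrier G"
    and p: "prime p" and u_notin: "u \<notin> H" and u_pow: "u [^] p \<in> H"
  shows "trivial_idempotent H \<otimes>\<^bsub>rat_group_algebra G\<^esub> e_elem p G u =
      trivial_idempotent (generate G (insert u H))"
    and "trivial_idempotent H \<otimes>\<^bsub>rat_group_algebra G\<^esub> e'_elem p G u =
      (\<lambda>x. trivial_idempotent H x - trivial_idempotent (generate G (insert u H)) x)"
proof -
  let ?K = "generate G (insert u H)" and ?A = "rat_group_algebra G"
  interpret A: cring ?A using fin by (rule cring_rat_group_algebra)
  note HG = subgroup.subset[OF H]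
  have sub: "subgroup ?K G" using u HG by (intro generate_is_subgroup) auto
  obtain idx where pcq: "prime_cyclic_quotient (G\<lparr>carrier := ?K\<rparr>) p idx"
    and ker: "cyclic_quotient.ker (G\<lparr>carrier := ?K\<rparr>) idx = H"
    and idx_u: "\<And>k :: nat. k < p \<Longrightarrow> idx (u [^] k) = k"
    using prime_cyclic_quotient_generate_insert[OF fin H u p u_notin u_pow] by metis
  interpret C: prime_cyclic_quotient "G\<lparr>carrier := ?K\<rparr>" p idx by fact
  have u_mem: "u [^] k \<in> ?K" for k :: nat
    by (intro subgroup_nat_pow_closed[OF sub] generate.incl) simp
  have "z \<in> C.ker \<longleftrightarrow> z \<in> ?K \<and> idx z = 0" for z by (simp add: C.ker_def)
  then have H_iff: "z \<in> H \<longleftrightarrow> z \<in> ?K \<and> idx z = 0" for z unfolding ker .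
  show mult: "trivial_idempotent H \<otimes>\<^bsub>?A\<^esub> e_elem p G u = trivial_idempotent ?K"
  proof
    fix x
    show "(trivial_idempotent H \<otimes>\<^bsub>?A\<^esub> e_elem p G u) x = trivial_idempotent ?K x"
    proof (cases "x \<in> carrier G")
      case x: True
      \<comment> \<open>Exactly one k below p qualifies for each x in K, namely
        \<open>idx x\<close>, and none for x outside K.\<close>
      have mem: "inv (u [^] k) \<otimes> x \<in> H \<longleftrightarrow> x \<in> ?K \<and> idx x = k" if k: "k < p" for k
      proof (cases "x \<in> ?K")
        case True
        have "inv (u [^] k) \<otimes> x \<in> ?K"
          using True u_mem by (intro subgroup.m_closed[OF sub] subgroup.m_inv_closed[OF sub])
        moreover have inv: "inv\<^bsub>G\<lparr>carrier := ?K\<rparr>\<^esub> (u [^] k) = inv (u [^] k)"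
          using sub u_mem by (rule m_inv_consistent)
        have "idx (inv\<^bsub>G\<lparr>carrier := ?K\<rparr>\<^esub> (u [^] k) \<otimes>\<^bsub>G\<lparr>carrier := ?K\<rparr>\<^esub> x) = 0 \<longleftrightarrow> idx (u [^] k) = idx x"
          by (rule C.idx_inv_mult_eq_0_iff) (use True u_mem in simp_all)
        then have "idx (inv (u [^] k) \<otimes> x) = 0 \<longleftrightarrow> idx x = k"
          unfolding inv idx_u[OF k] by (simp add: eq_commute[of k])
        ultimately show ?thesis using True H_iff[of "inv (u [^] k) \<otimes> x"] by argo
      next
        case False
        have "x = u [^] k \<otimes> (inv (u [^] k) \<otimes> x)" using u x by (simp flip: m_assoc)
        moreover have "H \<subseteq> ?K" by (auto intro: generate.incl)
        ultimately show ?thesis using False u_mem subgroup.m_closed[OF sub] by (metis subsetD)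
      qed
      have "(\<Sum>k<p. trivial_idempotent H (inv (u [^] k) \<otimes> x)) =
          (\<Sum>k<p. if idx x = k \<and> x \<in> ?K then 1 / of_nat (card H) else 0)"
        by (intro sum.cong) (auto simp: trivial_idempotent_def mem)
      also have "\<dots> = (if x \<in> ?K then 1 / of_nat (card H) else 0)"
        using C.idx_less[of x] by auto
      finally show ?thesis
        using C.card_carrier x by (simp add: mult_e_elem[OF fin u] trivial_idempotent_def ker)
    next
      case False
      then have "x \<notin> ?K" using subgroup.subset[OF sub] by blast
      with False show ?thesis by (simp add: mult_rat_group_algebra trivial_idempotent_def)
    qed
  qed
  have closed: "trivial_idempotent H \<in> carrier ?A" "e_elem p G u \<in> carrier ?A"
    using trivial_idempotent_closed[OF HG] e_elem_closed[OF is_group u] by auto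
  have "trivial_idempotent H \<otimes>\<^bsub>?A\<^esub> e'_elem p G u =
      trivial_idempotent H \<ominus>\<^bsub>?A\<^esub> trivial_idempotent H \<otimes>\<^bsub>?A\<^esub> e_elem p G u"
    using closed by (simp add: e'_elem_def a_minus_def A.r_distr A.r_minus)
  also have "\<dots> = (\<lambda>x. trivial_idempotent H x - trivial_idempotent ?K x)"
    using closed trivial_idempotent_closed[OF subgroup.subset[OF sub]] fin
    by (simp add: minus_rat_group_algebra mult)
  finally show "trivial_idempotent H \<otimes>\<^bsub>?A\<^esub> e'_elem p G u = \<dots>" .
qed

theorem mainTheorem5:
  fixes G :: "('a, 'b) monoid_scheme"
    and p m l N :: nat
    and r c :: "nat \<Rightarrow> nat"
    and x :: "nat \<Rightarrow> nat \<Rightarrow> nat \<Rightarrow> 'a"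
    and xs :: "'a list"
    and u :: 'a
    and S :: "nat \<Rightarrow> 'a set"
    and e :: "'a \<Rightarrow> rat"
  assumes "prime p"
    and "comm_group G"
    and "finite (carrier G)"
    and "\<exists>n. Coset.order G = p ^ n"
    and "long_presentation p G m r c x"
    and "xs = long_generators m r c x"
    and "N = length xs"
    and "S = generator_series G xs"
    and "l < N"
    and "e = trivial_idempotent (S l)"
    and "u = xs ! l"
  shows "{v \<in> pci_vertices G S N. fst v = Suc l \<and> {(l, e), v} \<in> pci_edges G S N} =
           {(Suc l, e \<otimes>\<^bsub>rat_group_algebra G\<^esub> e_elem p G u),
            (Suc l, e \<otimes>\<^bsub>rat_group_algebra G\<^esub> e'_elem p G u)} \<and>
         e \<otimes>\<^bsub>rat_group_algebra G\<^esub> e_elem p G u \<noteq> e \<otimes>\<^bsub>rat_group_algebra G\<^esub> e'_elem p G u"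
proof -
  interpret comm_group G by fact
  let ?K = "S (Suc l)" and ?A = "rat_group_algebra G"
  have l: "l < length (long_generators m r c x)" using assms by simp
  note step = generator_series_step[OF assms(3,1,5) l, folded assms(6), folded assms(8), folded assms(11)]
  have S: "subgroup (S l) G" and u: "u \<in> carrier G" and u_notin: "u \<notin> S l"
    and u_pow: "u [^]\<^bsub>G\<^esub> p \<in> S l" and K: "?K = generate G (insert u (S l))"
    using step by simp_all
  obtain idx where pcq: "prime_cyclic_quotient (G\<lparr>carrier := ?K\<rparr>) p idx"
    and ker: "cyclic_quotient.ker (G\<lparr>carrier := ?K\<rparr>) idx = S l"
    using prime_cyclic_quotient_generate_insert[OF assms(3) S u assms(1) u_notin u_pow]
    unfolding K by metis
  interpret C: prime_cyclic_quotient "G\<lparr>carrier := ?K\<rparr>" p idx by fact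
  have e_u: "e \<otimes>\<^bsub>?A\<^esub> e_elem p G u = C.e_carrier"
    using trivial_idempotent_mult_e_elem(1)[OF assms(3) S u assms(1) u_notin u_pow]
    by (simp add: assms(10) K)
  \<comment> \<open>The left side is computed in Q[G], while \<open>C.e_diff\<close> is a difference
    in Q[K]; both are the same pointwise difference of functions vanishing off K.\<close>
  have e'_u: "e \<otimes>\<^bsub>?A\<^esub> e'_elem p G u = C.e_diff"
    using trivial_idempotent_mult_e_elem(2)[OF assms(3) S u assms(1) u_notin u_pow]
      trivial_idempotent_closed[OF C.ker_subset] trivial_idempotent_closed[OF subset_refl[of "carrier (G\<lparr>carrier := ?K\<rparr>)"]]
      C.finite_carrier
    by (simp add: assms(10) C.minus_rat_group_algebra ker flip: K)
  interpret H: comm_group "G\<lparr>carrier := S l\<rparr>" using S by (rule subgroup_comm_group)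
  have "finite (S l)" using subgroup.subset[OF S] assms(3) by (rule finite_subset)
  then have "primitive_central_idempotent (rat_group_algebra (G\<lparr>carrier := S l\<rparr>)) e"
    using H.primitive_trivial_idempotent by (simp add: assms(10))
  then have vertex: "(l, e) \<in> pci_vertices G S N"
    using assms(9) by (simp add: pci_vertices_def)
  have br: "pci_branches G (S l) ?K e f \<longleftrightarrow>
      pci_branches (G\<lparr>carrier := ?K\<rparr>) C.ker (carrier (G\<lparr>carrier := ?K\<rparr>)) C.e_ker f" for f
    by (simp add: pci_branches_def ker assms(10))
  have "(Suc l, f) \<in> pci_vertices G S N \<and> {(l, e), (Suc l, f)} \<in> pci_edges G S N \<longleftrightarrow>
      f = C.e_carrier \<or> f = C.e_diff" for f
    using vertex assms(9) C.pci_branches_e_ker C.pci_branches_e_ker_imp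
      C.primitive_e_carrier C.primitive_e_diff
    unfolding pci_edges_iff br by (auto simp: pci_vertices_def)
  then have "{v \<in> pci_vertices G S N. fst v = Suc l \<and> {(l, e), v} \<in> pci_edges G S N} =
      {(Suc l, C.e_carrier), (Suc l, C.e_diff)}"
    by (auto simp: set_eq_iff)
  \<comment> \<open>At u, outside H, the idempotent of H vanishes, so the two elements take opposite
    nonzero values there.\<close>
  moreover have "C.e_carrier \<noteq> C.e_diff"
  proof
    assume eq: "C.e_carrier = C.e_diff"
    have "u \<in> ?K" unfolding K by (rule generate.incl) simp
    then have "C.e_carrier u > 0"
      using C.finite_carrier by (auto simp: trivial_idempotent_def card_gt_0_iff)
    moreover have "C.e_diff u = - C.e_carrier u"
      using trivial_idempotent_closed[OF C.ker_subset] trivial_idempotent_closed[OF subset_refl[of "carrier (G\<lparr>carrier := ?K\<rparr>)"]]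
        C.finite_carrier u_notin
      by (simp add: C.minus_rat_group_algebra) (simp add: trivial_idempotent_def ker)
    ultimately show False using eq by simp
  qed
  ultimately show ?thesis unfolding e_u e'_u by blast
qed
end
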